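(* (i) Let $a>0$. Among all triangles with area $1$ and a side of length $a$, the isosceles triangle with base $a$ maximizes $\rho_1$. (ii) Let $t_*$ be the unique positive root of the polynomial $$\frac{999}{64}x^4-93x^3-664x^2-5376x-9216.$$ If $0<a\le t_*^{1/4}$, then among all triangles with area $1$ and a side of length $a$, the isosceles triangle with base $a$ maximizes $\rho_2$. If $a>t_*^{1/4}$, then among all triangles with area $1$ and a side of length $a$, the isosceles triangle with base $a$ does not maximize $\rho_2$.
   Context: For a bounded simply connected region $\Omega\subseteq\mathbb{C}$ whose boundary is a Jordan curve and $N\in\mathbb{N}$, let $\mathcal{P}_N$ be the space of complex polynomials in $z$ of degree at most $N$, and let $dA$ denote area measure. Define $$\rho_N(\Omega):=\min_{p\in\mathcal{P}_N}\int_\Omega|\bar z-p(z)|^2\,dA(z),$$ the square of the distance from $\bar z$ to $\mathcal{P}_N$ in $L^2(\Omega,dA)$. Triangles are regarded as regions in $\mathbb{C}\cong\mathbb{R}^2$; $\rho_N$ is invariant under congruence. The base of an isosceles triangle is the side whose two adjacent sides have equal length; in an equilateral triangle any side may be considered as the base. "The isosceles triangle with base $a$" is the triangle (unique up to congruence) of area $1$ whose base has length $a$. A triangle maximizes $\rho_N$ in a class if it belongs to the class and its $\rho_N$ value is at least that of every other triangle in the class. *)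

theory Defs
  imports "HOL-Analysis.Analysis" "HOL-Computational_Algebra.Polynomial"
begin

(* The paper's minimum over polynomials is written as an infimum of a nonempty set of nonnegative
   reals; for bounded open regions of positive area it is attained, so the two agree. *)
definition rho :: "nat \<Rightarrow> complex set \<Rightarrow> real" where
  "rho N \<Omega> = (INF p\<in>{p :: complex poly. degree p \<le> N}.
                 (LINT z:\<Omega>|lborel. (cmod (cnj z - poly p z))\<^sup>2))"

definition triangle :: "complex \<Rightarrow> complex \<Rightarrow> complex \<Rightarrow> complex set" where
  "triangle u v w = interior (convex hull {u, v, w})"

(* A triangle does not depend on the order of its vertices, so the distinguished side may be
   taken to be the segment from u to v. *)
definition unit_triangles_with_side :: "real \<Rightarrow> complex set set" where
  "unit_triangles_with_side a = {triangle u v w | u v w.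
     \<not> collinear {u, v, w} \<and> measure lborel (triangle u v w) = 1 \<and> dist u v = a}"

(* All congruent copies of the isosceles triangle with base a. *)
definition isosceles_unit_triangles :: "real \<Rightarrow> complex set set" where
  "isosceles_unit_triangles a = {triangle u v w | u v w.
     \<not> collinear {u, v, w} \<and> measure lborel (triangle u v w) = 1 \<and> dist u v = a \<and>
     dist u w = dist v w}"

definition maximizes_rho :: "nat \<Rightarrow> complex set \<Rightarrow> complex set set \<Rightarrow> bool" where
  "maximizes_rho N T \<T> \<longleftrightarrow> T \<in> \<T> \<and> (\<forall>S\<in>\<T>. rho N S \<le> rho N T)"

definition threshold_poly :: "real poly" where
  "threshold_poly = [:- 9216, - 5376, - 664, - 93, 999 / 64:]"

definition t_star :: real where
  "t_star = (THE t. 0 < t \<and> poly threshold_poly t = 0)"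

lemma poly_threshold_poly:
  "poly threshold_poly x = 999 / 64 * x ^ 4 - 93 * x ^ 3 - 664 * x\<^sup>2 - 5376 * x - 9216"
  by (simp add: threshold_poly_def algebra_simps eval_nat_numeral)

lemma ex1_threshold_root: "\<exists>!t. 0 < t \<and> poly threshold_poly t = 0"
proof -
  have less: "poly threshold_poly y \<noteq> 0"
    if x: "0 < x" "poly threshold_poly x = 0" and "x < y" for x y :: real
  proof -
    define q where "q t = 93 / t + 664 / t ^ 2 + 5376 / t ^ 3 + 9216 / t ^ 4" for t :: real
    have eq: "poly threshold_poly t = t ^ 4 * (999 / 64 - q t)" if "t > 0" for t
      using that by (simp add: poly_threshold_poly q_def field_simps eval_nat_numeral)
    have "q y < q x"
      unfolding q_def using x(1) \<open>x < y\<close>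
      by (intro add_strict_mono divide_strict_left_mono power_strict_mono mult_pos_pos
          zero_less_power) auto
    then show ?thesis
      using eq[of x] eq[of y] x \<open>x < y\<close> by simp
  qed
  have "\<exists>t. 0 \<le> t \<and> t \<le> 100 \<and> poly threshold_poly t = 0"
    by (rule IVT) (auto simp: poly_threshold_poly)
  then obtain t where "0 \<le> t" "poly threshold_poly t = 0"
    by blast
  moreover from this have "t \<noteq> 0"
    by (auto simp: poly_threshold_poly)
  ultimately have "0 < t \<and> poly threshold_poly t = 0"
    by simp
  moreover have "s = t'" if "0 < s \<and> poly threshold_poly s = 0"
    "0 < t' \<and> poly threshold_poly t' = 0" for s t'
    using less[of s t'] less[of t' s] that by (meson linorder_neqE_linordered_idom)
  ultimately show ?thesis
    by blast
qed

lemma measure_stretch_Im: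
  assumes "h > 0" and A: "open (A :: complex set)"
  shows "measure lborel ((\<lambda>z. Complex (Re z) (h * Im z)) ` A) = h * measure lborel A"
proof -
  define L where "L z = Complex (Re z) (h * Im z)" for z
  define M where "M z = Complex (Re z) (Im z / h)" for z
  have LM: "L (M z) = z" "M (L z) = z" for z
    using \<open>h > 0\<close> by (simp_all add: L_def M_def)
  have contM: "continuous_on UNIV M" and contL: "continuous_on UNIV L"
    using \<open>h > 0\<close> unfolding L_def M_def Complex_eq by (auto intro!: continuous_intros)
  have img: "L ` A = M -` A"
    by (auto simp: LM) (metis LM(1) image_eqI)
  have open_img: "open (L ` A)"
    unfolding img using contM A by (simp add: open_vimage)
  have borel_L: "L \<in> borel_measurable borel"
    using contL by (rule borel_measurable_continuous_onI)
  have L_eq: "L = (\<lambda>z. 0 + (\<Sum>j\<in>Basis. ((if j = \<i> then h else 1) * (z \<bullet> j)) *\<^sub>R j))"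
    by (auto simp: L_def Basis_complex_def complex_eq_iff fun_eq_iff inner_complex_def)
  have "lborel = density (distr lborel borel L) (\<lambda>_. (\<Prod>j\<in>Basis. \<bar>if j = \<i> then h else 1\<bar>))"
    unfolding L_eq using \<open>h > 0\<close> by (subst lborel_affine_euclidean[symmetric]) auto
  also have "(\<Prod>j\<in>Basis. \<bar>if j = \<i> then h else 1\<bar>) = h"
    using \<open>h > 0\<close> by (simp add: Basis_complex_def)
  finally have "emeasure lborel (L ` A) = emeasure (density (distr lborel borel L) (\<lambda>_. h)) (L ` A)"
    by (rule arg_cong)
  also have "\<dots> = ennreal h * emeasure (distr lborel borel L) (L ` A)"
    using open_img by (subst emeasure_density_const) auto
  also have "emeasure (distr lborel borel L) (L ` A) = emeasure lborel (L -` (L ` A))"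
    using open_img borel_L by (subst emeasure_distr) auto
  also have "L -` (L ` A) = A"
    by (auto simp: image_iff) (metis LM(2))
  finally show ?thesis
    using \<open>h > 0\<close> unfolding L_def measure_def by (simp add: enn2real_mult)
qed

lemma isosceles_unit_triangles_nonempty:
  assumes "a > 0"
  shows "isosceles_unit_triangles a \<noteq> {}"
proof -
  define u v :: complex where "u = Complex (- a / 2) 0" and "v = Complex (a / 2) 0"
  define T where "T h = triangle u v (Complex 0 h)" for h
  have nc: "\<not> collinear {u, v, Complex 0 h}" if "h > 0" for h
  proof
    assume "collinear {u, v, Complex 0 h}"
    then have "collinear {u, Complex 0 h, v}"
      by (simp add: insert_commute)
    then show False
      using that assms by (auto simp: collinear_3_expand u_def v_def complex_eq_iff)
  qed
  have neq: "u \<noteq> v" "u \<noteq> \<i>" "v \<noteq> \<i>"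
    using assms by (auto simp: u_def v_def complex_eq_iff)
  have i_eq: "Complex 0 1 = \<i>"
    by (simp add: complex_eq_iff)
  have "open (T 1)" "bounded (T 1)"
    by (auto simp: T_def triangle_def intro: bounded_interior bounded_convex_hull finite_imp_bounded)
  have "\<not> affine_dependent {u, v, \<i>}"
    using nc[of 1] by (auto simp: collinear_3_eq_affine_dependent i_eq)
  moreover have "card {u, v, \<i>} = Suc DIM(complex)"
    using neq by simp
  ultimately have "T 1 \<noteq> {}"
    using interior_convex_hull_eq_empty[of "{u, v, \<i>}"] by (simp add: T_def triangle_def i_eq)
  have pos: "measure lborel (T 1) > 0"
  proof (rule ccontr)
    assume "\<not> ?thesis"
    then have "measure lborel (T 1) = 0"
      by (simp add: order_antisym not_less)
    moreover have "emeasure lborel (T 1) < \<infinity>"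
      using \<open>bounded (T 1)\<close> by (rule emeasure_bounded_finite)
    ultimately have "emeasure lborel (T 1) = 0"
      by (auto simp: measure_def enn2real_eq_0_iff)
    then have "T 1 \<in> null_sets lborel"
      using \<open>open (T 1)\<close> by (simp add: null_sets_def)
    then have "negligible (T 1)"
      by (simp add: negligible_iff_null_sets null_sets_completionI)
    then show False
      using open_not_negligible \<open>open (T 1)\<close> \<open>T 1 \<noteq> {}\<close> by blast
  qed
  define h where "h = 1 / measure lborel (T 1)"
  have "h > 0"
    using pos by (simp add: h_def)
  define L where "L z = Complex (Re z) (h * Im z)" for z
  have lin: "linear L"
    by (rule linearI) (simp_all add: L_def complex_eq_iff algebra_simps)
  have inj: "inj L"
    using \<open>h > 0\<close> by (auto simp: L_def inj_def complex_eq_iff)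
  have "T h = L ` T 1"
    unfolding T_def triangle_def
    by (simp add: interior_injective_linear_image[OF lin inj, symmetric]
        convex_hull_linear_image[OF lin]) (simp add: L_def u_def v_def)
  then have "measure lborel (T h) = 1"
    using measure_stretch_Im[OF \<open>h > 0\<close> \<open>open (T 1)\<close>] pos by (simp add: L_def h_def)
  moreover have "dist u v = a"
    using assms by (simp add: u_def v_def dist_complex_def norm_complex_def)
  moreover have "dist u (Complex 0 h) = dist v (Complex 0 h)"
    by (simp add: u_def v_def dist_complex_def norm_complex_def)
  ultimately have "T h \<in> isosceles_unit_triangles a"
    using nc[OF \<open>h > 0\<close>] unfolding isosceles_unit_triangles_def T_def by blast
  then show ?thesis
    by blast
qed

end

theory Submission
  imports Defs
begin

text \<open>
  Write a triangle of area 1 as the image of the equilateral triangle with vertices the cube roots of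
  unity under \<open>\<zeta> \<mapsto> c + \<alpha> \<zeta> + \<beta> cnj \<zeta>\<close>. By the threefold symmetry most moments of \<open>\<zeta>\<close> up to order 4
  vanish, and completing squares in the coefficients of \<open>p\<close> gives \<open>\<rho>\<^sub>1\<close> and \<open>\<rho>\<^sub>2\<close> in closed form. With
  \<open>B = a\<^sup>2\<close> and \<open>S\<close> one third of the sum of the squared side lengths, \<open>\<rho>\<^sub>1 = 4 / (9 S)\<close>, and
  \<open>\<rho>\<^sub>2\<close> is a rational function of \<open>B\<close> and \<open>S\<close>. For fixed \<open>a\<close>, \<open>S\<close> takes exactly the values
  \<open>S \<ge> S\<^sub>0 = B / 2 + 8 / (3 B)\<close>, and \<open>S = S\<^sub>0\<close> holds for the isosceles triangle with base \<open>a\<close>. So the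
  claim for \<open>\<rho>\<^sub>1\<close> is immediate. For \<open>\<rho>\<^sub>2\<close>, cross-multiplying \<open>\<rho>\<^sub>2(S) \<le> \<rho>\<^sub>2(S\<^sub>0)\<close> and splitting off the
  factor \<open>S - S\<^sub>0\<close> leaves a quadratic polynomial in \<open>S\<close>. It is nonnegative on \<open>[S\<^sub>0, \<infinity>)\<close> iff it is so
  at \<open>S\<^sub>0\<close>, where it is a negative multiple of the threshold polynomial at \<open>a\<^sup>4\<close>.
\<close>

subsection \<open>Integrals over triangles\<close>

lemma has_integral_beta_nat:
  "((\<lambda>x::real. x ^ i * (1 - x) ^ j) has_integral fact i * fact j / fact (i + j + 1)) {0..1}"
proof (induction j arbitrary: i)
  case 0
  have "((\<lambda>x. x ^ Suc i / real (Suc i)) has_real_derivative x ^ i) (at x within {0..1})" for x :: real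
    using DERIV_cdivide[OF DERIV_pow[of "Suc i" x], of "real (Suc i)"]
    by (simp del: of_nat_Suc)
  then have "((\<lambda>x::real. x ^ i) has_integral (1 ^ Suc i / real (Suc i) - 0 ^ Suc i / real (Suc i))) {0..1}"
    by (intro fundamental_theorem_of_calculus)
       (simp_all add: has_real_derivative_iff_has_vector_derivative)
  moreover have "fact i / (fact i + fact i * real i) = 1 / (1 + real i)"
    using mult_divide_mult_cancel_left[of "fact i :: real" 1 "1 + real i"] by (simp add: algebra_simps)
  ultimately show ?case by (simp add: algebra_simps)
next
  case (Suc j)
  \<comment> \<open>Integration by parts: \<open>F\<close> vanishes at both endpoints, and its
    derivative trades one power of \<open>1 - x\<close> for one of \<open>x\<close>. This is why the
    induction keeps \<open>i\<close> arbitrary.\<close>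
  define F where "F x = x ^ Suc i * (1 - x) ^ Suc j / real (Suc i)" for x :: real
  have "(F has_real_derivative x ^ i * (1 - x) ^ Suc j -
      real (Suc j) / real (Suc i) * (x ^ Suc i * (1 - x) ^ j)) (at x within {0..1})" for x
  proof -
    have "((\<lambda>x. 1 - x) has_real_derivative -1) (at x within {0..1})"
      by (auto intro!: derivative_eq_intros)
    from DERIV_power_Suc[OF this, of j] DERIV_power_Suc[OF DERIV_ident, of i]
    have "((\<lambda>x. x ^ Suc i * (1 - x) ^ Suc j) has_real_derivative
        real (Suc i) * x ^ i * (1 - x) ^ Suc j - x ^ Suc i * (real (Suc j) * (1 - x) ^ j))
        (at x within {0..1})"
      by (intro DERIV_cong[OF DERIV_mult]) (auto simp: algebra_simps)
    from DERIV_cdivide[OF this, of "real (Suc i)"] show ?thesis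
      unfolding F_def by (rule DERIV_cong) (simp add: diff_divide_distrib del: of_nat_Suc)
  qed
  then have "((\<lambda>x::real. x ^ i * (1 - x) ^ Suc j - real (Suc j) / real (Suc i) * (x ^ Suc i * (1 - x) ^ j))
          has_integral (F 1 - F 0)) {0..1}"
    by (intro fundamental_theorem_of_calculus)
       (simp_all add: has_real_derivative_iff_has_vector_derivative)
  from has_integral_add[OF this has_integral_mult_right[OF Suc.IH[of "Suc i"], of "real (Suc j) / real (Suc i)"]]
  have "((\<lambda>x::real. x ^ i * (1 - x) ^ Suc j) has_integral
     real (Suc j) / real (Suc i) * (fact (Suc i) * fact j / fact (Suc i + j + 1))) {0..1}"
    by (simp add: F_def)
  moreover have "real (Suc j) / real (Suc i) * (fact (Suc i) * fact j / fact (Suc i + j + 1)) =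
      fact i * fact (Suc j) / (fact (i + Suc j + 1) :: real)"
    by (simp add: fact_Suc [of i] fact_Suc [of j] del: fact_Suc of_nat_Suc)
  ultimately show ?case
    by metis
qed

definition std_simplex :: "(real \<times> real) set" where
  "std_simplex = {(x, y). 0 < x \<and> 0 < y \<and> x + y < 1}"

lemma open_std_simplex: "open std_simplex"
proof -
  have "std_simplex = {p. 0 < fst p} \<inter> {p. 0 < snd p} \<inter> {p. fst p + snd p < 1}"
    by (auto simp: std_simplex_def)
  also have "open \<dots>"
    by (intro open_Int open_Collect_less continuous_intros)
  finally show ?thesis .
qed

lemma std_simplex_measurable [measurable]: "std_simplex \<in> sets borel"
  using open_std_simplex by simp

lemma bounded_std_simplex: "bounded std_simplex"
proof (rule bounded_subset)
  show "bounded (cbox (0,0) (1::real,1::real))" by simp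
  show "std_simplex \<subseteq> cbox (0,0) (1,1)"
    by (auto simp: std_simplex_def cbox_Pair_eq)
qed

lemma set_integrable_std_simplex:
  fixes f :: "real \<times> real \<Rightarrow> real"
  assumes "continuous_on UNIV f"
  shows "set_integrable lborel std_simplex f"
proof -
  have "set_integrable lborel (closure std_simplex) f"
    unfolding set_integrable_def
    using bounded_std_simplex assms
    by (intro borel_integrable_compact) (auto intro: continuous_on_subset)
  then show ?thesis
    by (rule set_integrable_subset) (auto simp: closure_subset)
qed

text \<open>This is a Dirichlet integral: integrating over \<open>y\<close> from 0 to
  \<open>1 - x\<close> leaves a beta integral in \<open>x\<close>.\<close>

lemma std_simplex_moment:
  "(LINT p:std_simplex|lborel. fst p ^ i * snd p ^ j) = fact i * fact j / fact (i + j + 2)"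
proof -
  define f where "f p = indicator std_simplex p * (fst p ^ i * snd p ^ j)" for p :: "real \<times> real"
  have int: "integrable (lborel \<Otimes>\<^sub>M lborel) f"
    using set_integrable_std_simplex[of "\<lambda>p. fst p ^ i * snd p ^ j"]
    by (simp add: f_def [abs_def] set_integrable_def lborel_prod continuous_intros)
  have inner: "(LBINT y. f (x, y)) = indicator {0<..<1} x * (x ^ i * (1 - x) ^ Suc j / Suc j)" for x
  proof (cases "0 < x \<and> x < 1")
    case True
    have "(LBINT y. f (x, y)) = x ^ i * (LBINT y. y ^ j * indicator {0..1-x} y)"
    proof (subst integral_mult_right_zero [symmetric], rule integral_cong_AE)
      \<comment> \<open>The open section of the simplex and the closed interval differ only in the
        endpoints, a null set.\<close>
      have "AE y in lborel. y \<noteq> 0 \<and> y \<noteq> 1 - x"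
        using AE_lborel_singleton[of 0] AE_lborel_singleton[of "1-x"] by auto
      then show "AE y in lborel. f (x, y) = x ^ i * (y ^ j * indicator {0..1-x} y)"
        by eventually_elim (use True in \<open>auto simp: f_def std_simplex_def indicator_def\<close>)
      have "f \<in> borel_measurable (lborel \<Otimes>\<^sub>M lborel)"
        using int by (rule borel_measurable_integrable)
      then show "(\<lambda>y. f (x, y)) \<in> borel_measurable lborel"
        by (rule measurable_Pair2) simp
    qed auto
    also have "(LBINT y. y ^ j * indicator {0..1-x} y) = (1 - x) ^ Suc j / Suc j"
      using integral_power[of 0 "1-x" j] True by (simp add: mult.commute)
    finally show ?thesis using True by simp
  next
    case False
    then have "f (x, y) = 0" for y
      by (auto simp: f_def std_simplex_def indicator_def)
    then show ?thesis using False by auto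
  qed
  have "(LINT p:std_simplex|lborel. fst p ^ i * snd p ^ j) = integral\<^sup>L (lborel \<Otimes>\<^sub>M lborel) f"
    by (simp add: set_lebesgue_integral_def f_def [abs_def] lborel_prod)
  also have "\<dots> = (LBINT x. LBINT y. f (x, y))"
    using lborel_pair.integral_fst'[OF int] by simp
  also have "\<dots> = (LINT x:{0..1}|lborel. x ^ i * (1 - x) ^ Suc j / Suc j)"
    unfolding inner set_lebesgue_integral_def
  proof (rule integral_cong_AE)
    have "AE y in lborel. y \<noteq> 0 \<and> y \<noteq> (1::real)"
      using AE_lborel_singleton[of "0::real"] AE_lborel_singleton[of "1::real"] by auto
    then show "AE x in lborel. indicator {0<..<1} x * (x ^ i * (1 - x) ^ Suc j / Suc j) =
        indicator {0..1} x *\<^sub>R (x ^ i * (1 - x) ^ Suc j / Suc j)"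
      by eventually_elim (auto simp: indicator_def)
  qed auto
  also have "\<dots> = integral {0..1} (\<lambda>x. x ^ i * (1 - x) ^ Suc j / Suc j)"
    by (intro set_borel_integral_eq_integral(2) borel_integrable_compact[folded set_integrable_def])
       (auto intro!: continuous_intros simp del: of_nat_Suc)
  also have "\<dots> = fact i * fact (Suc j) / fact (i + Suc j + 1) / Suc j"
    by (rule integral_unique, rule has_integral_divide, rule has_integral_beta_nat)
  also have "\<dots> = fact i * fact j / fact (i + j + 2)"
    using mult_divide_mult_cancel_right[of "real (Suc j)" "fact i * fact j" "fact (i + j + 2)"]
    by (simp add: mult_ac del: of_nat_Suc fact_Suc) (simp add: mult_ac)
  finally show ?thesis .
qed

section \<open>Affine changes of variables in the complex plane\<close>

lemma nn_integral_complex: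
  fixes f :: "complex \<Rightarrow> ennreal"
  assumes [measurable]: "f \<in> borel_measurable borel"
  shows "(\<integral>\<^sup>+z. f z \<partial>lborel) = (\<integral>\<^sup>+x. \<integral>\<^sup>+y. f (Complex x y) \<partial>lborel \<partial>lborel)"
proof -
  define \<phi> where "\<phi> = (\<lambda>p. Complex (fst p) (snd p))"
  have [measurable]: "\<phi> \<in> borel \<rightarrow>\<^sub>M borel"
    unfolding \<phi>_def Complex_eq by (intro borel_measurable_continuous_onI continuous_intros)
  have "lborel = distr lborel borel \<phi>"
  proof (rule lborel_eqI)
    fix l u :: complex assume "\<And>b. b \<in> Basis \<Longrightarrow> l \<bullet> b \<le> u \<bullet> b"
    then have le: "Re l \<le> Re u" "Im l \<le> Im u"
      by (force simp: Basis_complex_def)+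
    have "\<phi> -` box l u = box (Re l, Im l) (Re u, Im u)"
      by (auto simp: \<phi>_def in_box_complex_iff box_prod)
    then have "emeasure (distr lborel borel \<phi>) (box l u) =
        emeasure (lborel \<Otimes>\<^sub>M lborel) ({Re l<..<Re u} \<times> {Im l<..<Im u})"
      by (simp add: emeasure_distr box_prod lborel_prod)
    then show "emeasure (distr lborel borel \<phi>) (box l u) = (\<Prod>b\<in>Basis. (u - l) \<bullet> b)"
      using le by (simp add: lborel.emeasure_pair_measure_Times ennreal_mult Basis_complex_def)
  qed simp
  then have "(\<integral>\<^sup>+z. f z \<partial>lborel) = (\<integral>\<^sup>+z. f z \<partial>distr lborel borel \<phi>)"
    by (rule arg_cong)
  also have "\<dots> = (\<integral>\<^sup>+p. f (\<phi> p) \<partial>(lborel \<Otimes>\<^sub>M lborel))"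
    by (simp add: nn_integral_distr lborel_prod)
  also have "\<dots> = (\<integral>\<^sup>+x. \<integral>\<^sup>+y. f (Complex x y) \<partial>lborel \<partial>lborel)"
    using measurable_compose[OF \<open>\<phi> \<in> borel \<rightarrow>\<^sub>M borel\<close> assms]
    by (subst lborel.nn_integral_fst [symmetric]) (simp_all add: \<phi>_def lborel_prod)
  finally show ?thesis .
qed

text \<open>Two one-dimensional substitutions suffice. For fixed \<open>y\<close> the real part
  replaces \<open>x\<close>, with factor \<open>Re d\<close>; after exchanging the integrals the
  imaginary part replaces \<open>y\<close>, with factor \<open>J / Re d\<close>. Their product is
  the determinant \<open>J\<close>.\<close>

lemma nn_integral_affine_complex_aux:
  fixes f :: "complex \<Rightarrow> ennreal"
  assumes [measurable]: "f \<in> borel_measurable borel"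
    and J: "Re d * Im e - Im d * Re e \<noteq> 0" and "Re d \<noteq> 0"
  shows "(\<integral>\<^sup>+z. f z \<partial>lborel) = \<bar>Re d * Im e - Im d * Re e\<bar> *
    (\<integral>\<^sup>+y. \<integral>\<^sup>+x. f (w + of_real x * d + of_real y * e) \<partial>lborel \<partial>lborel)"
proof -
  define J where "J = Re d * Im e - Im d * Re e"
  have [measurable]: "(\<lambda>p. Complex (fst p) (snd p)) \<in> borel \<rightarrow>\<^sub>M borel"
    unfolding Complex_eq by (intro borel_measurable_continuous_onI continuous_intros)
  have [measurable]: "(\<lambda>x. Complex (g x) (h x)) \<in> borel_measurable M"
    if [measurable]: "g \<in> borel_measurable M" "h \<in> borel_measurable M" for g h :: "'a \<Rightarrow> real" and M
    unfolding Complex_eq by measurable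
  \<comment> \<open>\<open>g y X\<close> is the value of \<open>f\<close> at the point with second
    coordinate \<open>y\<close> and real part \<open>X\<close>.\<close>
  define g where "g y X = f (Complex X (Im w + Im d * (X - Re w) / Re d + J / Re d * y))" for y X
  have "(\<integral>\<^sup>+x. f (w + of_real x * d + of_real y * e) \<partial>lborel) =
      ennreal (1 / \<bar>Re d\<bar>) * (\<integral>\<^sup>+X. g y X \<partial>lborel)" for y
  proof -
    have "(\<integral>\<^sup>+X. g y X \<partial>lborel) = \<bar>Re d\<bar> * (\<integral>\<^sup>+x. g y ((Re w + y * Re e) + Re d * x) \<partial>lborel)"
      unfolding g_def by (intro nn_integral_real_affine \<open>Re d \<noteq> 0\<close>) measurable
    also have "(\<lambda>x. g y ((Re w + y * Re e) + Re d * x)) = (\<lambda>x. f (w + of_real x * d + of_real y * e))"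
      unfolding g_def
      by (intro ext arg_cong[of _ _ f])
         (use \<open>Re d \<noteq> 0\<close> in \<open>simp add: complex_eq_iff J_def field_simps\<close>)
    finally show ?thesis
      using \<open>Re d \<noteq> 0\<close> by (simp add: mult.assoc [symmetric] ennreal_mult [symmetric])
  qed
  then have "(\<integral>\<^sup>+y. \<integral>\<^sup>+x. f (w + of_real x * d + of_real y * e) \<partial>lborel \<partial>lborel) =
      ennreal (1 / \<bar>Re d\<bar>) * (\<integral>\<^sup>+y. \<integral>\<^sup>+X. g y X \<partial>lborel \<partial>lborel)"
    unfolding g_def by (simp add: nn_integral_cmult)
  also have "(\<integral>\<^sup>+y. \<integral>\<^sup>+X. g y X \<partial>lborel \<partial>lborel) = (\<integral>\<^sup>+X. \<integral>\<^sup>+y. g y X \<partial>lborel \<partial>lborel)"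
    unfolding g_def by (rule lborel_pair.Fubini') measurable
  also have "\<dots> = ennreal (\<bar>Re d\<bar> / \<bar>J\<bar>) * (\<integral>\<^sup>+z. f z \<partial>lborel)"
  proof -
    have "(\<integral>\<^sup>+y. g y X \<partial>lborel) = ennreal (\<bar>Re d\<bar> / \<bar>J\<bar>) * (\<integral>\<^sup>+Y. f (Complex X Y) \<partial>lborel)" for X
    proof -
      have "J / Re d \<noteq> 0"
        using J \<open>Re d \<noteq> 0\<close> by (simp add: J_def)
      then have "(\<integral>\<^sup>+Y. f (Complex X Y) \<partial>lborel) = \<bar>J / Re d\<bar> * (\<integral>\<^sup>+y. g y X \<partial>lborel)"
        unfolding g_def by (intro nn_integral_real_affine) measurable
      then show ?thesis
        using J \<open>Re d \<noteq> 0\<close>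
        by (simp add: mult.assoc [symmetric] ennreal_mult [symmetric] J_def [symmetric])
    qed
    then show ?thesis
      by (simp add: nn_integral_cmult nn_integral_complex)
  qed
  finally show ?thesis
    using J \<open>Re d \<noteq> 0\<close>
    by (simp add: mult.assoc [symmetric] ennreal_mult [symmetric] J_def [symmetric])
qed

lemma nn_integral_affine_complex:
  fixes f :: "complex \<Rightarrow> ennreal"
  assumes [measurable]: "f \<in> borel_measurable borel"
    and J: "Re d * Im e - Im d * Re e \<noteq> 0"
  shows "(\<integral>\<^sup>+z. f z \<partial>lborel) = \<bar>Re d * Im e - Im d * Re e\<bar> *
    (\<integral>\<^sup>+p. f (w + of_real (fst p) * d + of_real (snd p) * e) \<partial>lborel)"
proof -
  have prod: "(\<integral>\<^sup>+p. f (w + of_real (fst p) * d + of_real (snd p) * e) \<partial>lborel) =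
     (\<integral>\<^sup>+x. \<integral>\<^sup>+y. f (w + of_real x * d + of_real y * e) \<partial>lborel \<partial>lborel)"
    unfolding lborel_prod [symmetric]
    by (subst lborel.nn_integral_fst [symmetric]) auto
  have swap: "(\<integral>\<^sup>+x. \<integral>\<^sup>+y. f (w + of_real x * d + of_real y * e) \<partial>lborel \<partial>lborel) =
    (\<integral>\<^sup>+y. \<integral>\<^sup>+x. f (w + of_real x * d + of_real y * e) \<partial>lborel \<partial>lborel)"
    by (rule lborel_pair.Fubini') measurable
  show ?thesis
  proof (cases "Re d = 0")
    case False
    then show ?thesis
      unfolding prod swap by (intro nn_integral_affine_complex_aux assms)
  next
    case True
    \<comment> \<open>If \<open>d\<close> is vertical, the nonzero determinant forces
      \<open>Re e \<noteq> 0\<close>, so \<open>d\<close> and \<open>e\<close> can exchange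
      roles.\<close>
    then have "Re e \<noteq> 0" "Re e * Im d - Im e * Re d \<noteq> 0"
      using J by auto
    from nn_integral_affine_complex_aux[OF assms(1) this(2,1), of w] show ?thesis
      unfolding prod by (simp add: abs_minus_commute mult.commute add_ac)
  qed
qed

text \<open>Passing through an identity of measures, checked on indicators, gives the formula for
  every Borel function with no integrability condition.\<close>

lemma integral_affine_complex:
  fixes f :: "complex \<Rightarrow> real"
  assumes [measurable]: "f \<in> borel_measurable borel"
    and J: "Re d * Im e - Im d * Re e \<noteq> 0"
  shows "(LINT z|lborel. f z) = \<bar>Re d * Im e - Im d * Re e\<bar> *
    (LINT p|lborel. f (w + of_real (fst p) * d + of_real (snd p) * e))"
proof -
  define \<phi> where "\<phi> = (\<lambda>p::real\<times>real. w + of_real (fst p) * d + of_real (snd p) * e)"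
  have [measurable]: "\<phi> \<in> borel \<rightarrow>\<^sub>M borel"
    unfolding \<phi>_def by (intro borel_measurable_continuous_onI continuous_intros)
  let ?J = "\<bar>Re d * Im e - Im d * Re e\<bar>"
  have "(lborel :: complex measure) = density (distr lborel borel \<phi>) (\<lambda>_. ennreal ?J)"
  proof (rule measure_eqI)
    fix A :: "complex set" assume "A \<in> sets lborel"
    then have [measurable]: "A \<in> sets borel" by simp
    have "emeasure lborel A = (\<integral>\<^sup>+z. indicator A z \<partial>lborel)"
      by simp
    also have "\<dots> = ?J * (\<integral>\<^sup>+p. indicator A (\<phi> p) \<partial>lborel)"
      unfolding \<phi>_def by (rule nn_integral_affine_complex[OF _ J]) measurable
    also have "(\<integral>\<^sup>+p. indicator A (\<phi> p) \<partial>lborel) = (\<integral>\<^sup>+z. indicator A z \<partial>distr lborel borel \<phi>)"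
      by (subst nn_integral_distr) auto
    also have "ennreal ?J * \<dots> = emeasure (density (distr lborel borel \<phi>) (\<lambda>_. ennreal ?J)) A"
      by (simp add: emeasure_density nn_integral_cmult)
    finally show "emeasure lborel A = emeasure (density (distr lborel borel \<phi>) (\<lambda>_. ennreal ?J)) A" .
  qed simp
  then have "(LINT z|lborel. f z) = (LINT z|density (distr lborel borel \<phi>) (\<lambda>_. ennreal ?J). f z)"
    by (rule arg_cong)
  also have "\<dots> = ?J * (LINT p|lborel. f (\<phi> p))"
    by (subst integral_density) (auto simp: integral_distr)
  finally show ?thesis by (simp add: \<phi>_def)
qed

section \<open>Mean squares of quadratic polynomials\<close>

lemma std_simplex_square_poly:
  assumes "finite M"
  shows "(LINT p:std_simplex|lborel. (\<Sum>(i, j)\<in>M. k (i, j) * fst p ^ i * snd p ^ j)\<^sup>2) =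
    (\<Sum>(i, j)\<in>M. \<Sum>(i', j')\<in>M. k (i, j) * k (i', j') *
      (fact (i + i') * fact (j + j') / fact (i + i' + (j + j') + 2)))"
proof -
  have int: "set_integrable lborel std_simplex (\<lambda>p. fst p ^ i * snd p ^ j)" for i j
    by (intro set_integrable_std_simplex continuous_intros)
  have "(LINT p:std_simplex|lborel. (\<Sum>(i, j)\<in>M. k (i, j) * fst p ^ i * snd p ^ j)\<^sup>2) =
    (LINT p:std_simplex|lborel. (\<Sum>(i, j)\<in>M. \<Sum>(i', j')\<in>M. k (i, j) * k (i', j') *
       (fst p ^ (i + i') * snd p ^ (j + j'))))"
    by (simp add: power2_eq_square sum_product case_prod_unfold power_add mult_ac)
  also have "\<dots> = (\<Sum>(i, j)\<in>M. \<Sum>(i', j')\<in>M. k (i, j) * k (i', j') *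
      (LINT p:std_simplex|lborel. fst p ^ (i + i') * snd p ^ (j + j')))"
    using int unfolding set_lebesgue_integral_def set_integrable_def case_prod_unfold
    by (simp add: sum_distrib_left mult.left_commute[of "indicator _ _"] integral_sum)
  finally show ?thesis
    by (simp only: std_simplex_moment)
qed

lemma std_simplex_square_quadratic:
  "(LINT p:std_simplex|lborel. (k0 + k1 * fst p + k2 * snd p + k3 * (fst p)\<^sup>2 +
      k4 * (fst p * snd p) + k5 * (snd p)\<^sup>2)\<^sup>2) =
   k0\<^sup>2 / 2 + k0 * k1 / 3 + k0 * k2 / 3 + k1\<^sup>2 / 12 + k2\<^sup>2 / 12 + k1 * k2 / 12 +
   k0 * k3 / 6 + k0 * k4 / 12 + k0 * k5 / 6 +
   k1 * k3 / 10 + k1 * k4 / 30 + k1 * k5 / 30 + k2 * k3 / 30 + k2 * k4 / 30 + k2 * k5 / 10 +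
   k3\<^sup>2 / 30 + k3 * k4 / 60 + k3 * k5 / 90 + k4\<^sup>2 / 180 + k4 * k5 / 60 + k5\<^sup>2 / 30"
proof -
  define M :: "(nat \<times> nat) set" where "M = {(0, 0), (1, 0), (0, 1), (2, 0), (1, 1), (0, 2)}"
  define k :: "nat \<times> nat \<Rightarrow> real" where "k = (\<lambda>_. 0)((0, 0) := k0, (1, 0) := k1, (0, 1) := k2,
    (2, 0) := k3, (1, 1) := k4, (0, 2) := k5)"
  have [simp]: "k (0,0) = k0" "k (Suc 0,0) = k1" "k (0,Suc 0) = k2"
      "k (2,0) = k3" "k (Suc 0, Suc 0) = k4" "k (0,2) = k5"
    by (auto simp: k_def)
  have "(\<Sum>(i, j)\<in>M. k (i, j) * x ^ i * y ^ j) =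
      k0 + k1 * x + k2 * y + k3 * x\<^sup>2 + k4 * (x * y) + k5 * y\<^sup>2" for x y
    by (simp add: M_def)
  then show ?thesis
    using std_simplex_square_poly[of M k]
    by (simp add: M_def) (simp add: fact_numeral power2_eq_square field_simps)
qed

text \<open>Here \<open>X + \<i> Y\<close> ranges over the equilateral triangle whose vertices are the cube roots of unity.\<close>
lemma std_simplex_square_quadratic_equilateral:
  defines "X p \<equiv> 1 - 3 / 2 * (fst p + snd p)" and "Y p \<equiv> sqrt 3 / 2 * (fst p - snd p)"
  shows "2 * (LINT p:std_simplex|lborel. (r0 + r1 * X p + r2 * Y p + r3 * (X p)\<^sup>2 +
      r4 * (X p * Y p) + r5 * (Y p)\<^sup>2)\<^sup>2) =
   r0\<^sup>2 + r0 * (r3 + r5) / 4 + (r1\<^sup>2 + r2\<^sup>2) / 8 + (r1 * r3 - r1 * r5 - r2 * r4) / 20 +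
   (3 * r3\<^sup>2 + 3 * r5\<^sup>2 + r4\<^sup>2 + 2 * r3 * r5) / 80"
proof -
  have "r0 + r1 * X p + r2 * Y p + r3 * (X p)\<^sup>2 + r4 * (X p * Y p) + r5 * (Y p)\<^sup>2 =
    (r0 + r1 + r3) + (-3/2 * r1 + sqrt 3 / 2 * r2 - 3 * r3 + sqrt 3 / 2 * r4) * fst p +
    (-3/2 * r1 - sqrt 3 / 2 * r2 - 3 * r3 - sqrt 3 / 2 * r4) * snd p +
    (9/4 * r3 - 3 * sqrt 3 / 4 * r4 + 3/4 * r5) * (fst p)\<^sup>2 +
    (9/2 * r3 - 3/2 * r5) * (fst p * snd p) +
    (9/4 * r3 + 3 * sqrt 3 / 4 * r4 + 3/4 * r5) * (snd p)\<^sup>2" for p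
    by (simp add: X_def Y_def power2_eq_square field_simps)
  moreover have "sqrt 3 * sqrt 3 = 3" "sqrt 3 * (sqrt 3 * x) = 3 * x" for x
    by (simp_all flip: mult.assoc)
  ultimately show ?thesis
    by (simp only: std_simplex_square_quadratic) (simp add: power2_eq_square field_simps)
qed

text \<open>Twice the integral over the simplex is the mean over the equilateral triangle. The
  right-hand side records its nonzero moments: \<open>|\<zeta>|\<^sup>2\<close> has mean 1/4, while
  \<open>\<zeta>\<^sup>3\<close> and \<open>|\<zeta>|\<^sup>4\<close> have mean 1/10; the other
  mixed moments involved vanish by rotation.\<close>

lemma std_simplex_norm_quadratic:
  defines "\<zeta> p \<equiv> Complex (1 - 3 / 2 * (fst p + snd p)) (sqrt 3 / 2 * (fst p - snd p))"
  shows "2 * (LINT p:std_simplex|lborel. (cmod (A0 + A1 * \<zeta> p + A2 * cnj (\<zeta> p) + A3 * (\<zeta> p)\<^sup>2 +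
      A4 * (\<zeta> p * cnj (\<zeta> p)) + A5 * (cnj (\<zeta> p))\<^sup>2))\<^sup>2) =
    (cmod A0)\<^sup>2 + Re (A0 * cnj A4) / 2 + ((cmod A1)\<^sup>2 + (cmod A2)\<^sup>2) / 4 +
    Re (A1 * cnj A5 + A2 * cnj A3) / 5 + ((cmod A3)\<^sup>2 + (cmod A4)\<^sup>2 + (cmod A5)\<^sup>2) / 10"
proof -
  define X Y where "X p = 1 - 3 / 2 * (fst p + snd p)" and "Y p = sqrt 3 / 2 * (fst p - snd p)"
    for p :: "real \<times> real"
  define Q where "Q r0 r1 r2 r3 r4 r5 p =
    (r0 + r1 * X p + r2 * Y p + r3 * (X p)\<^sup>2 + r4 * (X p * Y p) + r5 * (Y p)\<^sup>2)\<^sup>2"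
    for r0 r1 r2 r3 r4 r5 p
  note E = std_simplex_square_quadratic_equilateral[folded X_def Y_def, folded Q_def]
  have int: "set_integrable lborel std_simplex (Q r0 r1 r2 r3 r4 r5)" for r0 r1 r2 r3 r4 r5
    unfolding Q_def X_def Y_def by (intro set_integrable_std_simplex continuous_intros)
  \<comment> \<open>Real and imaginary part of the expression are real quadratics in
    \<open>X p\<close> and \<open>Y p\<close>, so the real formula applies to each.\<close>
  have "(cmod (A0 + A1 * \<zeta> p + A2 * cnj (\<zeta> p) + A3 * (\<zeta> p)\<^sup>2 +
      A4 * (\<zeta> p * cnj (\<zeta> p)) + A5 * (cnj (\<zeta> p))\<^sup>2))\<^sup>2 =
    Q (Re A0) (Re A1 + Re A2) (Im A2 - Im A1) (Re A3 + Re A4 + Re A5)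
      (2 * Im A5 - 2 * Im A3) (Re A4 - Re A3 - Re A5) p +
    Q (Im A0) (Im A1 + Im A2) (Re A1 - Re A2) (Im A3 + Im A4 + Im A5)
      (2 * Re A3 - 2 * Re A5) (Im A4 - Im A3 - Im A5) p" for p
    unfolding \<zeta>_def X_def [symmetric] Y_def [symmetric] Q_def cmod_power2
    by (intro arg_cong2[where f = "(+)"] arg_cong[of _ _ "\<lambda>t. t\<^sup>2"])
       (simp_all add: power2_eq_square algebra_simps)
  then show ?thesis
    using int
    by (simp add: set_integral_add distrib_left E, simp only: cmod_power2)
       (simp add: power2_eq_square field_simps)
qed

section \<open>Triangles as affine images of the standard simplex\<close>

definition signed_parallelogram :: "complex \<Rightarrow> complex \<Rightarrow> complex \<Rightarrow> real" where
  "signed_parallelogram u v w = Im (cnj (u - w) * (v - w))"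

lemma collinear_iff_signed_parallelogram: "collinear {u, v, w} \<longleftrightarrow> signed_parallelogram u v w = 0"
proof -
  have "collinear {u, v, w} \<longleftrightarrow> collinear {u, w, v}"
    by (simp add: insert_commute)
  also have "\<dots> \<longleftrightarrow> collinear {0, u - w, v - w}"
    by (rule collinear_3) simp
  also have "\<dots> \<longleftrightarrow> Im ((v - w) / (u - w)) = 0"
    by (simp add: collinear_iff_Reals complex_is_Real_iff)
  also have "\<dots> \<longleftrightarrow> signed_parallelogram u v w = 0"
    by (cases "u = w") (auto simp: signed_parallelogram_def Im_divide complex_eq_iff algebra_simps)
  finally show ?thesis .
qed

text \<open>The open triangle consists of the points with positive barycentric coordinates, so it is
  the injective affine image of the open simplex. The determinant of that map is
  \<open>signed_parallelogram u v w\<close>.\<close>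

lemma integral_triangle:
  fixes f :: "complex \<Rightarrow> real"
  assumes f: "continuous_on UNIV f" and nc: "\<not> collinear {u, v, w}"
  shows "(LINT z:interior (convex hull {u, v, w})|lborel. f z) =
    \<bar>signed_parallelogram u v w\<bar> *
    (LINT p:std_simplex|lborel. f (w + of_real (fst p) * (u - w) + of_real (snd p) * (v - w)))"
proof -
  define T where "T = interior (convex hull {u, v, w})"
  define \<phi> where "\<phi> p = w + of_real (fst p) * (u - w) + of_real (snd p) * (v - w)" for p :: "real \<times> real"
  define J where "J = Re (u - w) * Im (v - w) - Im (u - w) * Re (v - w)"
  have J_eq: "J = signed_parallelogram u v w"
    by (simp add: J_def signed_parallelogram_def algebra_simps)
  then have J: "J \<noteq> 0"
    using nc by (simp add: collinear_iff_signed_parallelogram)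
  have inj: "inj \<phi>"
  proof (rule injI)
    fix p q assume eq: "\<phi> p = \<phi> q"
    have "(fst p - fst q) * Re (u - w) + (snd p - snd q) * Re (v - w) = 0"
      using arg_cong[OF eq, of Re] by (simp add: \<phi>_def algebra_simps)
    moreover have "(fst p - fst q) * Im (u - w) + (snd p - snd q) * Im (v - w) = 0"
      using arg_cong[OF eq, of Im] by (simp add: \<phi>_def algebra_simps)
    \<comment> \<open>Cramer's rule for the two linear equations in the coordinate
      differences.\<close>
    ultimately have "(fst p - fst q) * J = 0" "(snd p - snd q) * J = 0"
      unfolding J_def by algebra+
    then show "p = q"
      using J by (simp add: prod_eq_iff)
  qed
  have "T = \<phi> ` std_simplex"
  proof -
    have "T = {z. \<exists>x y t. 0 < x \<and> 0 < y \<and> 0 < t \<and> x + y + t = 1 \<and> x *\<^sub>R u + y *\<^sub>R v + t *\<^sub>R w = z}"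
      unfolding T_def using nc by (rule interior_convex_hull_3_minimal) simp
    also have "\<dots> = {z. \<exists>x y. 0 < x \<and> 0 < y \<and> x + y < 1 \<and> z = \<phi> (x, y)}"
    proof (intro Collect_cong iffI; elim exE conjE)
      fix z x y t assume "0 < x" "0 < y" "0 < t" "x + y + t = 1" "x *\<^sub>R u + y *\<^sub>R v + t *\<^sub>R w = z"
      moreover from this have "t = 1 - x - y" by simp
      ultimately show "\<exists>x y. 0 < x \<and> 0 < y \<and> x + y < 1 \<and> z = \<phi> (x, y)"
        by (intro exI[of _ x] exI[of _ y]) (auto simp: \<phi>_def scaleR_conv_of_real algebra_simps)
    next
      fix z x y assume "0 < x" "0 < y" "x + y < 1" "z = \<phi> (x, y)"
      then show "\<exists>x y t. 0 < x \<and> 0 < y \<and> 0 < t \<and> x + y + t = 1 \<and> x *\<^sub>R u + y *\<^sub>R v + t *\<^sub>R w = z"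
        by (intro exI[of _ x] exI[of _ y] exI[of _ "1 - x - y"])
           (auto simp: \<phi>_def scaleR_conv_of_real algebra_simps)
    qed
    also have "\<dots> = \<phi> ` std_simplex"
      by (auto simp: std_simplex_def)
    finally show ?thesis .
  qed
  then have ind: "indicator T (\<phi> p) = (indicator std_simplex p :: real)" for p
    using inj by (auto simp: indicator_def inj_image_mem_iff)
  have [measurable]: "f \<in> borel_measurable borel"
    using f by (rule borel_measurable_continuous_onI)
  have [measurable]: "T \<in> sets borel"
    by (simp add: T_def)
  have "(LINT z|lborel. indicator T z * f z) = \<bar>J\<bar> * (LINT p|lborel. indicator T (\<phi> p) * f (\<phi> p))"
    unfolding \<phi>_def J_def by (rule integral_affine_complex) (use J in \<open>auto simp: J_def\<close>)
  then show ?thesis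
    unfolding ind by (simp add: J_eq set_lebesgue_integral_def T_def \<phi>_def)
qed

subsection \<open>The least squares problem\<close>

lemma complete_square_complex:
  fixes k :: real and x b :: complex
  assumes "k \<noteq> 0"
  shows "k * (cmod x)\<^sup>2 + 2 * Re (cnj x * b) = k * (cmod (x + b / of_real k))\<^sup>2 - (cmod b)\<^sup>2 / k"
proof -
  have "(cmod (x + b / of_real k))\<^sup>2 = (cmod x)\<^sup>2 + 2 * Re (cnj x * b) / k + (cmod b)\<^sup>2 / k\<^sup>2"
    using assms unfolding cmod_power2 by (simp add: field_simps power2_eq_square)
  then show ?thesis
    using assms by (simp add: field_simps power2_eq_square)
qed

lemma norm_add_square_le: "(cmod (x + y))\<^sup>2 \<le> 2 * ((cmod x)\<^sup>2 + (cmod y)\<^sup>2)"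
proof -
  have "0 \<le> (cmod (x - y))\<^sup>2"
    by simp
  also have "\<dots> = 2 * ((cmod x)\<^sup>2 + (cmod y)\<^sup>2) - (cmod (x + y))\<^sup>2"
    unfolding cmod_power2 by (simp add: power2_eq_square algebra_simps)
  finally show ?thesis by simp
qed

locale linear_pair =
  fixes \<alpha> \<beta> :: complex
  assumes nonzero: "\<alpha> \<noteq> 0 \<or> \<beta> \<noteq> 0"
begin

text \<open>For \<open>z = \<alpha> \<zeta> + \<beta> cnj \<zeta>\<close> with \<zeta> in the
  equilateral triangle, \<open>\<sigma> / 4\<close> is the mean of \<open>|z|\<^sup>2\<close>, and
  \<delta> is the Jacobian determinant of the map from \<zeta> to \<open>z\<close>.\<close>

definition "\<sigma> = (cmod \<alpha>)\<^sup>2 + (cmod \<beta>)\<^sup>2"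
definition "\<delta> = (cmod \<alpha>)\<^sup>2 - (cmod \<beta>)\<^sup>2"
text \<open>
  With \<open>z = \<alpha> \<zeta> + \<beta> cnj \<zeta>\<close> centred, \<open>energy c0 c1 c2\<close> is the mean of \<open>|cnj z - (c0 + c1 z + c2 z\<^sup>2)|\<^sup>2\<close>.
  After eliminating \<open>c0\<close> and \<open>c1\<close>, its coefficient of \<open>|c2|\<^sup>2\<close> is \<open>K\<close>, and \<open>\<eta> / 10\<close> is the inner product of the
  residual of \<open>cnj z\<close> with \<open>z\<^sup>2\<close>.
\<close>
definition "\<eta> = of_real (\<delta> / \<sigma>) * (cnj \<alpha> ^ 3 - cnj \<beta> ^ 3)"
text \<open>\<open>\<kappa> / 10\<close> is the mean of \<open>z * (cnj z)\<^sup>2\<close>, the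
  inner product of \<open>z\<close> with \<open>z\<^sup>2\<close>; it couples \<open>c1\<close> and
  \<open>c2\<close>.\<close>

definition "\<kappa> = \<alpha> * (cnj \<beta>)\<^sup>2 + \<beta> * (cnj \<alpha>)\<^sup>2"
definition "K = \<sigma>\<^sup>2 / 10 - (cmod \<alpha>)\<^sup>2 * (cmod \<beta>)\<^sup>2 / 20 - (cmod \<kappa>)\<^sup>2 / (25 * \<sigma>)"
definition "energy c0 c1 c2 =
    (cmod c0)\<^sup>2 + Re (c0 * cnj (2 * \<alpha> * \<beta> * c2)) / 2 +
    ((cmod (cnj \<beta> - c1 * \<alpha>))\<^sup>2 + (cmod (cnj \<alpha> - c1 * \<beta>))\<^sup>2) / 4 -
    Re ((cnj \<beta> - c1 * \<alpha>) * cnj (c2 * \<beta>\<^sup>2) + (cnj \<alpha> - c1 * \<beta>) * cnj (c2 * \<alpha>\<^sup>2)) / 5 +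
    ((cmod (c2 * \<alpha>\<^sup>2))\<^sup>2 + (cmod (2 * \<alpha> * \<beta> * c2))\<^sup>2 + (cmod (c2 * \<beta>\<^sup>2))\<^sup>2) / 10"

lemma \<sigma>_pos: "\<sigma> > 0"
  using nonzero by (auto simp: \<sigma>_def add_pos_nonneg add_nonneg_pos)

text \<open>With \<open>p\<close> and \<open>q\<close> the squared norms of \<alpha> and \<beta>,
  the \<kappa> term is at most \<open>2 * p * q / 25\<close>, and \<open>p * q\<close> is at most
  \<open>\<sigma>\<^sup>2 / 4\<close>. Hence \<open>K\<close> is at least
  \<open>27 / 400 * \<sigma>\<^sup>2\<close>.\<close>

lemma K_pos: "K > 0"
proof -
  define p q where "p = (cmod \<alpha>)\<^sup>2" and "q = (cmod \<beta>)\<^sup>2"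
  have "(cmod \<kappa>)\<^sup>2 \<le> 2 * ((cmod (\<alpha> * (cnj \<beta>)\<^sup>2))\<^sup>2 + (cmod (\<beta> * (cnj \<alpha>)\<^sup>2))\<^sup>2)"
    unfolding \<kappa>_def by (rule norm_add_square_le)
  also have "\<dots> = 2 * p * q * \<sigma>"
    by (simp add: norm_mult norm_power p_def q_def \<sigma>_def power2_eq_square algebra_simps)
  finally have "(cmod \<kappa>)\<^sup>2 / (25 * \<sigma>) \<le> 2 * p * q / 25"
    using \<sigma>_pos by (simp add: field_simps)
  moreover have "4 * (p * q) \<le> \<sigma>\<^sup>2"
    using zero_le_power2[of "p - q"]
    by (simp add: \<sigma>_def p_def q_def power2_eq_square algebra_simps)
  moreover have "\<sigma>\<^sup>2 > 0"
    using \<sigma>_pos by simp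
  ultimately show ?thesis
    unfolding K_def p_def [symmetric] q_def [symmetric] by argo
qed

text \<open>Squares are completed in \<open>c0\<close>, then \<open>c1\<close>, then
  \<open>c2\<close>. The minimum and its location can then be read off, since
  \<open>\<sigma>\<close> and \<open>K\<close> are positive.\<close>

lemma energy_eq:
  "energy c0 c1 c2 = (cmod (c0 + \<alpha> * \<beta> * c2 / 2))\<^sup>2 + \<delta>\<^sup>2 / (4 * \<sigma>) +
     \<sigma> / 4 * (cmod (c1 - 2 * cnj (\<alpha> * \<beta>) / \<sigma> + 2 * c2 * cnj \<kappa> / (5 * \<sigma>)))\<^sup>2 +
     K * (cmod (c2 - \<eta> / (10 * K)))\<^sup>2 - (cmod \<eta>)\<^sup>2 / (100 * K)"
proof -
  \<comment> \<open>\<open>v\<close> is the deviation of \<open>c1\<close> from its optimal value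
    for \<open>c2 = 0\<close>.\<close>
  define v where "v = c1 - 2 * cnj (\<alpha> * \<beta>) / \<sigma>"
  have s: "\<sigma> \<noteq> 0" using \<sigma>_pos by simp
  have sc: "complex_of_real \<sigma> = \<alpha> * cnj \<alpha> + \<beta> * cnj \<beta>"
    unfolding \<sigma>_def of_real_add complex_norm_square ..
  have dc: "complex_of_real \<delta> = \<alpha> * cnj \<alpha> - \<beta> * cnj \<beta>"
    unfolding \<delta>_def of_real_diff complex_norm_square ..
  have 1: "(cmod c0)\<^sup>2 + Re (c0 * cnj (2 * \<alpha> * \<beta> * c2)) / 2 =
     (cmod (c0 + \<alpha> * \<beta> * c2 / 2))\<^sup>2 - (cmod (\<alpha> * \<beta> * c2))\<^sup>2 / 4"
    using complete_square_complex[of 1 c0 "\<alpha> * \<beta> * c2 / 2"]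
    by (simp add: norm_divide power_divide algebra_simps)
  have 2: "(cmod (cnj \<beta> - c1 * \<alpha>))\<^sup>2 + (cmod (cnj \<alpha> - c1 * \<beta>))\<^sup>2 = \<sigma> * (cmod v)\<^sup>2 + \<delta>\<^sup>2 / \<sigma>"
  proof -
    define X where "X = (cnj \<beta> - c1 * \<alpha>) * cnj (cnj \<beta> - c1 * \<alpha>) +
      (cnj \<alpha> - c1 * \<beta>) * cnj (cnj \<alpha> - c1 * \<beta>)"
    have v: "v * \<sigma> = c1 * \<sigma> - 2 * cnj (\<alpha> * \<beta>)" "cnj v * \<sigma> = cnj c1 * \<sigma> - 2 * (\<alpha> * \<beta>)"
      using s by (simp_all add: v_def field_simps)
    \<comment> \<open>Clearing the denominator \<sigma> and expressing \<sigma> and \<delta> through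
      conjugates makes this a polynomial identity.\<close>
    have "X * \<sigma> = (v * \<sigma>) * (cnj v * \<sigma>) + (complex_of_real \<delta>)\<^sup>2"
      unfolding v unfolding X_def sc dc by (simp add: algebra_simps power2_eq_square)
    then have "X = \<sigma> * (v * cnj v) + (complex_of_real \<delta>)\<^sup>2 / \<sigma>"
      using s by (simp add: field_simps)
    then have "complex_of_real ((cmod (cnj \<beta> - c1 * \<alpha>))\<^sup>2 + (cmod (cnj \<alpha> - c1 * \<beta>))\<^sup>2) =
      complex_of_real (\<sigma> * (cmod v)\<^sup>2 + \<delta>\<^sup>2 / \<sigma>)"
      unfolding of_real_add of_real_mult of_real_divide complex_norm_square
      unfolding X_def of_real_power .
    then show ?thesis
      unfolding of_real_eq_iff .
  qed
  have 3: "(cnj \<beta> - c1 * \<alpha>) * cnj (c2 * \<beta>\<^sup>2) + (cnj \<alpha> - c1 * \<beta>) * cnj (c2 * \<alpha>\<^sup>2) =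
      cnj c2 * (\<eta> - v * \<kappa>)"
  proof -
    have e: "\<eta> * \<sigma> = of_real \<delta> * (cnj \<alpha> ^ 3 - cnj \<beta> ^ 3)"
      using s by (simp add: \<eta>_def)
    have v: "v * \<sigma> = c1 * \<sigma> - 2 * cnj (\<alpha> * \<beta>)"
      using s by (simp add: v_def field_simps)
    have "((cnj \<beta> - c1 * \<alpha>) * cnj (c2 * \<beta>\<^sup>2) + (cnj \<alpha> - c1 * \<beta>) * cnj (c2 * \<alpha>\<^sup>2)) * \<sigma> =
      cnj c2 * (\<eta> * \<sigma> - (v * \<sigma>) * \<kappa>)"
      unfolding e v unfolding sc dc \<kappa>_def by (simp add: algebra_simps power2_eq_square power3_eq_cube)
    also have "\<dots> = cnj c2 * (\<eta> - v * \<kappa>) * \<sigma>"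
      by (simp add: algebra_simps)
    finally show ?thesis
      using s by simp
  qed
  have 4: "\<sigma> / 4 * (cmod v)\<^sup>2 + Re (cnj c2 * (v * \<kappa>)) / 5 =
    \<sigma> / 4 * (cmod (v + 2 * c2 * cnj \<kappa> / (5 * \<sigma>)))\<^sup>2 - (cmod c2)\<^sup>2 * (cmod \<kappa>)\<^sup>2 / (25 * \<sigma>)"
  proof -
    have "Re (cnj c2 * (v * \<kappa>)) = Re (cnj v * (c2 * cnj \<kappa>))"
      by (simp add: algebra_simps)
    then show ?thesis
      using complete_square_complex[of "\<sigma> / 4" v "c2 * cnj \<kappa> / 10"] s
      by (simp add: norm_mult norm_divide power_mult_distrib power_divide field_simps)
  qed
  have 5: "K * (cmod c2)\<^sup>2 - Re (cnj c2 * \<eta>) / 5 =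
     K * (cmod (c2 - \<eta> / (10 * K)))\<^sup>2 - (cmod \<eta>)\<^sup>2 / (100 * K)"
  proof -
    have "2 * Re (cnj c2 * (- \<eta> / 10)) = - Re (cnj c2 * \<eta>) / 5"
      by (simp add: field_simps)
    moreover have "- \<eta> / 10 / of_real K = - (\<eta> / (10 * K))"
      by simp
    moreover have "(cmod (- \<eta> / 10))\<^sup>2 / K = (cmod \<eta>)\<^sup>2 / (100 * K)"
      by (simp add: norm_divide power_divide)
    moreover have "K * (cmod c2)\<^sup>2 + 2 * Re (cnj c2 * (- \<eta> / 10)) =
        K * (cmod (c2 + - \<eta> / 10 / of_real K))\<^sup>2 - (cmod (- \<eta> / 10))\<^sup>2 / K"
      using K_pos by (intro complete_square_complex) simp
    ultimately show ?thesis
      by (metis add_uminus_conv_diff minus_divide_left)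
  qed
  \<comment> \<open>The two subtracted terms are left over from the squares in \<open>c0\<close> and
    \<open>c1\<close>.\<close>
  have 6: "((cmod (c2 * \<alpha>\<^sup>2))\<^sup>2 + (cmod (2 * \<alpha> * \<beta> * c2))\<^sup>2 + (cmod (c2 * \<beta>\<^sup>2))\<^sup>2) / 10 -
      (cmod (\<alpha> * \<beta> * c2))\<^sup>2 / 4 - (cmod c2)\<^sup>2 * (cmod \<kappa>)\<^sup>2 / (25 * \<sigma>) = K * (cmod c2)\<^sup>2"
    by (simp add: K_def norm_mult norm_power power_mult_distrib)
       (simp add: \<sigma>_def power2_eq_square power4_eq_xxxx algebra_simps)
  have "energy c0 c1 c2 = (cmod (c0 + \<alpha> * \<beta> * c2 / 2))\<^sup>2 + \<delta>\<^sup>2 / (4 * \<sigma>) +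
     (\<sigma> / 4 * (cmod v)\<^sup>2 + Re (cnj c2 * (v * \<kappa>)) / 5) - Re (cnj c2 * \<eta>) / 5 +
     (((cmod (c2 * \<alpha>\<^sup>2))\<^sup>2 + (cmod (2 * \<alpha> * \<beta> * c2))\<^sup>2 + (cmod (c2 * \<beta>\<^sup>2))\<^sup>2) / 10 -
      (cmod (\<alpha> * \<beta> * c2))\<^sup>2 / 4)"
    unfolding energy_def 1 2 3 by (simp add: algebra_simps add_divide_distrib diff_divide_distrib)
  also have "\<dots> = (cmod (c0 + \<alpha> * \<beta> * c2 / 2))\<^sup>2 + \<delta>\<^sup>2 / (4 * \<sigma>) +
     \<sigma> / 4 * (cmod (v + 2 * c2 * cnj \<kappa> / (5 * \<sigma>)))\<^sup>2 +
     (K * (cmod c2)\<^sup>2 - Re (cnj c2 * \<eta>) / 5)"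
    unfolding 4 6 [symmetric] by simp
  finally show ?thesis
    unfolding 5 by (simp add: v_def)
qed

lemma energy_ge: "\<delta>\<^sup>2 / (4 * \<sigma>) - (cmod \<eta>)\<^sup>2 / (100 * K) \<le> energy c0 c1 c2"
  unfolding energy_eq using \<sigma>_pos K_pos by (simp add: field_simps)

lemma energy_attained: "\<exists>c0 c1 c2. energy c0 c1 c2 = \<delta>\<^sup>2 / (4 * \<sigma>) - (cmod \<eta>)\<^sup>2 / (100 * K)"
proof -
  define c2 where "c2 = \<eta> / (10 * K)"
  define c1 where "c1 = 2 * cnj (\<alpha> * \<beta>) / \<sigma> - 2 * c2 * cnj \<kappa> / (5 * \<sigma>)"
  have "energy (- (\<alpha> * \<beta> * c2 / 2)) c1 c2 = \<delta>\<^sup>2 / (4 * \<sigma>) - (cmod \<eta>)\<^sup>2 / (100 * K)"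
    unfolding energy_eq by (simp add: c1_def c2_def)
  then show ?thesis by blast
qed

text \<open>At \<open>c2 = 0\<close> the last two terms of \<open>energy_eq\<close> cancel.\<close>

lemma energy_linear_eq:
  "energy c0 c1 0 = (cmod c0)\<^sup>2 + \<delta>\<^sup>2 / (4 * \<sigma>) +
     \<sigma> / 4 * (cmod (c1 - 2 * cnj (\<alpha> * \<beta>) / \<sigma>))\<^sup>2"
  unfolding energy_eq using K_pos by (simp add: norm_divide power_divide power2_eq_square field_simps)

lemma energy_linear_ge: "\<delta>\<^sup>2 / (4 * \<sigma>) \<le> energy c0 c1 0"
  unfolding energy_linear_eq using \<sigma>_pos by simp

lemma energy_linear_attained: "\<exists>c0 c1. energy c0 c1 0 = \<delta>\<^sup>2 / (4 * \<sigma>)"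
  by (rule exI[of _ 0], rule exI[of _ "2 * cnj (\<alpha> * \<beta>) / \<sigma>"]) (simp add: energy_linear_eq)

end

section \<open>Triangles of area 1 and their least squares distance\<close>

lemma measure_triangle:
  assumes "\<not> collinear {u, v, w}"
  shows "measure lborel (triangle u v w) = \<bar>signed_parallelogram u v w\<bar> / 2"
proof -
  have "measure lborel (triangle u v w) = (LINT z:triangle u v w|lborel. 1)"
    by (simp add: set_lebesgue_integral_def)
  also have "\<dots> = \<bar>signed_parallelogram u v w\<bar> * (LINT p:std_simplex|lborel. 1::real)"
    unfolding triangle_def using assms by (intro integral_triangle) auto
  also have "(LINT p:std_simplex|lborel. 1::real) = 1 / 2"
    using std_simplex_moment[of 0 0] by simp
  finally show ?thesis by simp
qed

lemma poly_degree_le_2: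
  fixes p :: "'a::comm_semiring_1 poly"
  assumes "degree p \<le> 2"
  shows "poly p x = coeff p 0 + coeff p 1 * x + coeff p 2 * x\<^sup>2"
proof -
  have "poly p x = (\<Sum>i\<le>2. coeff p i * x ^ i)"
    unfolding poly_altdef using assms by (auto intro!: sum.mono_neutral_left intro: le_degree)
  then show ?thesis
    by (simp add: numeral_2_eq_2)
qed

text \<open>The parallelogram has twice the area of the triangle. The assumption also rules out
  collinear vertices.\<close>

locale unit_area_triangle =
  fixes u v w :: complex
  assumes area: "\<bar>signed_parallelogram u v w\<bar> = 2"
begin

text \<open>The vertices \<open>w\<close>, \<open>u\<close>, \<open>v\<close> correspond to \<open>\<zeta> = 1\<close> and the two primitive cube roots of unity.\<close>
definition "centroid = (u + v + w) / 3"
text \<open>\<alpha> and \<beta> are the nonconstant discrete Fourier coefficients of the vertex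
  list \<open>w\<close>, \<open>u\<close>, \<open>v\<close>.\<close>

definition "\<alpha> = (2 * w - u - v) / 6 - \<i> * sqrt 3 * ((u - v) / 6)"
definition "\<beta> = (2 * w - u - v) / 6 + \<i> * sqrt 3 * ((u - v) / 6)"

lemma signed_parallelogram_square: "(signed_parallelogram u v w)\<^sup>2 = 4"
proof -
  have "(signed_parallelogram u v w)\<^sup>2 = \<bar>signed_parallelogram u v w\<bar>\<^sup>2"
    by simp
  then show ?thesis
    unfolding area by simp
qed

text \<open>The Jacobian is, up to sign, the ratio of the area 1 to the area
  \<open>3 * sqrt 3 / 4\<close> of the equilateral triangle.\<close>

lemma norm_diff_square: "((cmod \<alpha>)\<^sup>2 - (cmod \<beta>)\<^sup>2)\<^sup>2 = 16 / 27"
proof -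
  have "(cmod \<alpha>)\<^sup>2 - (cmod \<beta>)\<^sup>2 = 2 * sqrt 3 / 9 * signed_parallelogram u v w"
    unfolding cmod_power2 \<alpha>_def \<beta>_def signed_parallelogram_def
    by (simp add: power2_eq_square field_simps)
  then show ?thesis
    by (simp only: power_mult_distrib power_divide signed_parallelogram_square) simp
qed

sublocale linear_pair \<alpha> \<beta>
  using norm_diff_square by unfold_locales auto

lemma \<delta>_square: "\<delta>\<^sup>2 = 16 / 27"
  using norm_diff_square by (simp add: \<delta>_def)

lemma \<sigma>_eq: "\<sigma> = ((dist u v)\<^sup>2 + (dist u w)\<^sup>2 + (dist v w)\<^sup>2) / 9"
  unfolding \<sigma>_def
  unfolding \<alpha>_def \<beta>_def dist_norm cmod_power2
  by (simp add: power2_eq_square field_simps)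

text \<open>In the coordinate \<zeta> the residual is a combination of the six monomials of
  \<open>std_simplex_norm_quadratic\<close>. Area 1 makes the integral a mean.\<close>

lemma integral_triangle_quadratic:
  "(LINT z:triangle u v w|lborel. (cmod (cnj (z - centroid) - (c0 + c1 * (z - centroid) + c2 * (z - centroid)\<^sup>2)))\<^sup>2) =
    energy c0 c1 c2"
proof -
  define \<zeta> where "\<zeta> p = Complex (1 - 3 / 2 * (fst p + snd p)) (sqrt 3 / 2 * (fst p - snd p))" for p
  have nc: "\<not> collinear {u, v, w}"
    using area by (simp add: collinear_iff_signed_parallelogram)
  have z: "w + of_real (fst p) * (u - w) + of_real (snd p) * (v - w) - centroid =
      \<alpha> * \<zeta> p + \<beta> * cnj (\<zeta> p)" for p
    by (auto simp: centroid_def \<alpha>_def \<beta>_def \<zeta>_def complex_eq_iff field_simps)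
  have "(LINT z:triangle u v w|lborel. (cmod (cnj (z - centroid) - (c0 + c1 * (z - centroid) + c2 * (z - centroid)\<^sup>2)))\<^sup>2) =
     2 * (LINT p:std_simplex|lborel. (cmod (cnj (\<alpha> * \<zeta> p + \<beta> * cnj (\<zeta> p)) -
       (c0 + c1 * (\<alpha> * \<zeta> p + \<beta> * cnj (\<zeta> p)) + c2 * (\<alpha> * \<zeta> p + \<beta> * cnj (\<zeta> p))\<^sup>2)))\<^sup>2)"
    unfolding triangle_def z [symmetric] area [symmetric]
    using nc by (intro integral_triangle) (auto intro!: continuous_intros)
  moreover have "cnj (\<alpha> * \<zeta> p + \<beta> * cnj (\<zeta> p)) -
       (c0 + c1 * (\<alpha> * \<zeta> p + \<beta> * cnj (\<zeta> p)) + c2 * (\<alpha> * \<zeta> p + \<beta> * cnj (\<zeta> p))\<^sup>2) =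
     - c0 + (cnj \<beta> - c1 * \<alpha>) * \<zeta> p + (cnj \<alpha> - c1 * \<beta>) * cnj (\<zeta> p) + (- c2 * \<alpha>\<^sup>2) * (\<zeta> p)\<^sup>2 +
       (- (2 * \<alpha> * \<beta> * c2)) * (\<zeta> p * cnj (\<zeta> p)) + (- c2 * \<beta>\<^sup>2) * (cnj (\<zeta> p))\<^sup>2" for p
    by (simp add: power2_eq_square algebra_simps)
  ultimately have "(LINT z:triangle u v w|lborel. (cmod (cnj (z - centroid) - (c0 + c1 * (z - centroid) + c2 * (z - centroid)\<^sup>2)))\<^sup>2) =
    (cmod (- c0))\<^sup>2 + Re (- c0 * cnj (- (2 * \<alpha> * \<beta> * c2))) / 2 +
    ((cmod (cnj \<beta> - c1 * \<alpha>))\<^sup>2 + (cmod (cnj \<alpha> - c1 * \<beta>))\<^sup>2) / 4 +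
    Re ((cnj \<beta> - c1 * \<alpha>) * cnj (- c2 * \<beta>\<^sup>2) + (cnj \<alpha> - c1 * \<beta>) * cnj (- c2 * \<alpha>\<^sup>2)) / 5 +
    ((cmod (- c2 * \<alpha>\<^sup>2))\<^sup>2 + (cmod (- (2 * \<alpha> * \<beta> * c2)))\<^sup>2 + (cmod (- c2 * \<beta>\<^sup>2))\<^sup>2) / 10"
    by (simp only: std_simplex_norm_quadratic [folded \<zeta>_def])
  then show ?thesis
    by (simp only: energy_def norm_minus_cancel
        complex_cnj_minus mult_minus_left mult_minus_right minus_minus minus_add_distrib [symmetric]
        uminus_complex.sel minus_divide_left [symmetric])
qed

text \<open>Writing \<open>p(z) = q(z - centroid) + cnj centroid\<close> is a bijection on
  polynomials of degree at most \<open>N\<close>, and the constant absorbs the translation of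
  \<open>cnj z\<close>. The index set lists the coefficients of \<open>q\<close>.\<close>

lemma rho_triangle_INF:
  assumes "N \<le> 2"
  shows "rho N (triangle u v w) = (INF c\<in>{(c0, c1, c2). (N < 2 \<longrightarrow> c2 = 0) \<and> (N < 1 \<longrightarrow> c1 = 0)}.
    case c of (c0, c1, c2) \<Rightarrow> energy c0 c1 c2)"
proof -
  define I where "I p = (LINT z:triangle u v w|lborel. (cmod (cnj z - poly p z))\<^sup>2)" for p
  have I: "I (pcompose (q + [:cnj centroid:]) [:- centroid, 1:]) = energy (coeff q 0) (coeff q 1) (coeff q 2)"
    if "degree q \<le> 2" for q
    using integral_triangle_quadratic[of "coeff q 0" "coeff q 1" "coeff q 2"]
    by (simp add: I_def poly_pcompose poly_degree_le_2[OF that] algebra_simps)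
  show ?thesis
    unfolding rho_def I_def [symmetric]
  proof (rule arg_cong[where f = Inf], intro equalityI subsetI)
    fix y assume "y \<in> I ` {p. degree p \<le> N}"
    then obtain p where p: "y = I p" "degree p \<le> N"
      by auto
    define q where "q = pcompose p [:centroid, 1:] - [:cnj centroid:]"
    have "degree (pcompose p [:centroid, 1:]) \<le> N"
      using p by (simp add: degree_pcompose)
    then have q: "degree q \<le> N"
      unfolding q_def by (intro degree_diff_le) auto
    have "pcompose (q + [:cnj centroid:]) [:- centroid, 1:] = p"
      by (simp add: q_def flip: pcompose_assoc) (simp add: pcompose_pCons)
    with I[of q] q p assms have "y = energy (coeff q 0) (coeff q 1) (coeff q 2)"
      by simp
    moreover have "N < 2 \<longrightarrow> coeff q 2 = 0" "N < 1 \<longrightarrow> coeff q 1 = 0"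
      using q by (auto intro!: coeff_eq_0)
    ultimately show "y \<in> (\<lambda>(c0, c1, c2). energy c0 c1 c2) `
        {(c0, c1, c2). (N < 2 \<longrightarrow> c2 = 0) \<and> (N < 1 \<longrightarrow> c1 = 0)}"
      by (auto simp: image_iff)
  next
    fix y assume "y \<in> (\<lambda>(c0, c1, c2). energy c0 c1 c2) `
        {(c0, c1, c2). (N < 2 \<longrightarrow> c2 = 0) \<and> (N < 1 \<longrightarrow> c1 = 0)}"
    then obtain c0 c1 c2 where y: "y = energy c0 c1 c2"
      and c: "N < 2 \<longrightarrow> c2 = 0" "N < 1 \<longrightarrow> c1 = 0" by auto
    define q where "q = [:c0, c1, c2:]"
    have q: "degree q \<le> N"
      using c by (auto simp: q_def)
    have "y = I (pcompose (q + [:cnj centroid:]) [:- centroid, 1:])"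
      using I[of q] q assms y by (simp add: q_def numeral_2_eq_2)
    moreover have "degree (q + [:cnj centroid:]) \<le> N"
      using q by (intro degree_add_le) auto
    ultimately show "y \<in> I ` {p. degree p \<le> N}"
      by (auto intro!: imageI simp: degree_pcompose)
  qed
qed

lemma rho_1_triangle_norms: "rho 1 (triangle u v w) = \<delta>\<^sup>2 / (4 * \<sigma>)"
proof -
  have "rho 1 (triangle u v w) = (INF c\<in>{(c0, c1, c2). c2 = 0}. case c of (c0, c1, c2) \<Rightarrow> energy c0 c1 c2)"
    using rho_triangle_INF[of 1] by simp
  also have "\<dots> = \<delta>\<^sup>2 / (4 * \<sigma>)"
  proof (rule cInf_eq_minimum)
    obtain c0 c1 where "energy c0 c1 0 = \<delta>\<^sup>2 / (4 * \<sigma>)"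
      using energy_linear_attained by blast
    then show "\<delta>\<^sup>2 / (4 * \<sigma>) \<in> (\<lambda>(c0, c1, c2). energy c0 c1 c2) ` {(c0, c1, c2). c2 = 0}"
      by (intro image_eqI[where x = "(c0, c1, 0)"]) auto
  qed (use energy_linear_ge in auto)
  finally show ?thesis .
qed

lemma rho_2_triangle_norms:
  "rho 2 (triangle u v w) = \<delta>\<^sup>2 / (4 * \<sigma>) - (cmod \<eta>)\<^sup>2 / (100 * K)" (is "_ = ?R")
proof -
  have "rho 2 (triangle u v w) = (INF c. case c of (c0, c1, c2) \<Rightarrow> energy c0 c1 c2)"
    using rho_triangle_INF[of 2] by (simp add: split_def)
  also have "\<dots> = ?R"
  proof (rule cInf_eq_minimum)
    obtain c0 c1 c2 where "energy c0 c1 c2 = ?R"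
      using energy_attained by blast
    then show "?R \<in> range (\<lambda>(c0, c1, c2). energy c0 c1 c2)"
      by (intro image_eqI[where x = "(c0, c1, c2)"]) auto
  qed (use energy_ge in auto)
  finally show ?thesis .
qed

end

subsection \<open>Dependence on the side lengths\<close>

text \<open>For a triangle of area 1 this is \<open>400 * \<sigma> * K\<close>, see
  \<open>rho2_denom_eq\<close>. The polynomial itself also takes negative values, so its positivity
  is always drawn from a triangle.\<close>

definition rho2_denom :: "real \<Rightarrow> real \<Rightarrow> real" where
  "rho2_denom B S = S ^ 3 + 4 / 3 * B * S\<^sup>2 - (16 / 9 * B\<^sup>2 + 16 / 27) * S + 16 / 27 * B ^ 3 + 64 / 27 * B"

definition rho2_fun :: "real \<Rightarrow> real \<Rightarrow> real" where
  "rho2_fun B S = 4 / 9 * (S\<^sup>2 - 16 / 27) / rho2_denom B S"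

text \<open>With base \<open>a\<close> and height \<open>2 / a\<close>, both legs have squared
  length \<open>B / 4 + 4 / B\<close>, where \<open>B\<close> is the square of
  \<open>a\<close>.\<close>

definition iso_S :: "real \<Rightarrow> real" where
  "iso_S B = B / 2 + 8 / (3 * B)"

text \<open>The arguments of \<alpha> and \<beta> enter the norms of \<kappa> and \<eta> only
  through the real part of \<open>(\<alpha> * cnj \<beta>) ^ 3\<close>, which \<open>Re_cube\<close>
  reduces to that of \<open>\<alpha> * cnj \<beta>\<close>.\<close>

lemma (in linear_pair) norm_\<kappa>:
  "(cmod \<kappa>)\<^sup>2 = (cmod \<alpha>)\<^sup>2 * (cmod \<beta>)\<^sup>2 * \<sigma> + 2 * Re ((\<alpha> * cnj \<beta>) ^ 3)"
  unfolding \<kappa>_def \<sigma>_def cmod_power2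
  by (simp add: power2_eq_square power3_eq_cube algebra_simps)

lemma (in linear_pair) norm_\<eta>:
  "(cmod \<eta>)\<^sup>2 = \<delta>\<^sup>2 / \<sigma>\<^sup>2 *
     (\<sigma> ^ 3 - 3 * (cmod \<alpha>)\<^sup>2 * (cmod \<beta>)\<^sup>2 * \<sigma> - 2 * Re ((\<alpha> * cnj \<beta>) ^ 3))"
proof -
  have "(cmod (cnj \<alpha> ^ 3 - cnj \<beta> ^ 3))\<^sup>2 =
      \<sigma> ^ 3 - 3 * (cmod \<alpha>)\<^sup>2 * (cmod \<beta>)\<^sup>2 * \<sigma> - 2 * Re ((\<alpha> * cnj \<beta>) ^ 3)"
    unfolding \<sigma>_def cmod_power2
    by (simp add: power2_eq_square power3_eq_cube algebra_simps)
  moreover have "(cmod \<eta>)\<^sup>2 = \<delta>\<^sup>2 / \<sigma>\<^sup>2 * (cmod (cnj \<alpha> ^ 3 - cnj \<beta> ^ 3))\<^sup>2"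
    unfolding \<eta>_def norm_mult power_mult_distrib norm_of_real power2_abs power_divide ..
  ultimately show ?thesis
    by simp
qed

lemma Re_cube: "2 * Re (z ^ 3) = (2 * Re z) ^ 3 - 3 * (cmod z)\<^sup>2 * (2 * Re z)"
  unfolding cmod_power2 by (simp add: power2_eq_square power3_eq_cube algebra_simps)

context unit_area_triangle
begin

definition "B = (dist u v)\<^sup>2"
definition "S = ((dist u v)\<^sup>2 + (dist u w)\<^sup>2 + (dist v w)\<^sup>2) / 3"

lemma \<sigma>_S: "\<sigma> = S / 3"
  by (simp add: \<sigma>_eq S_def)

text \<open>Since \<open>u - v = \<i> * sqrt 3 * (\<alpha> - \<beta>)\<close>, the number
  \<open>B\<close> is three times the squared norm of \<open>\<alpha> - \<beta>\<close>.\<close>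

lemma Re_\<alpha>_cnj_\<beta>: "2 * Re (\<alpha> * cnj \<beta>) = \<sigma> - B / 3"
  unfolding \<sigma>_eq B_def
  unfolding \<alpha>_def \<beta>_def dist_norm cmod_power2
  by (simp add: power2_eq_square field_simps)

lemma norm_product_eq: "4 * ((cmod \<alpha>)\<^sup>2 * (cmod \<beta>)\<^sup>2) = \<sigma>\<^sup>2 - 16 / 27"
  unfolding \<delta>_square [symmetric] \<sigma>_def \<delta>_def by (simp add: power2_eq_square algebra_simps)

lemma Re_cube_\<alpha>_cnj_\<beta>: "2 * Re ((\<alpha> * cnj \<beta>) ^ 3) =
   (\<sigma> - B / 3) ^ 3 - 3 * ((cmod \<alpha>)\<^sup>2 * (cmod \<beta>)\<^sup>2) * (\<sigma> - B / 3)"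
  unfolding Re_cube Re_\<alpha>_cnj_\<beta> by (simp add: norm_mult power_mult_distrib)

lemma rho2_denom_eq: "rho2_denom B S = 400 * \<sigma> * K"
proof -
  define m where "m = (cmod \<alpha>)\<^sup>2 * (cmod \<beta>)\<^sup>2"
  have m: "m = (\<sigma>\<^sup>2 - 16 / 27) / 4"
    using norm_product_eq by (simp add: m_def)
  have "400 * \<sigma> * K = 40 * \<sigma> ^ 3 - 20 * m * \<sigma> - 16 * (cmod \<kappa>)\<^sup>2"
    using \<sigma>_pos by (simp add: K_def m_def power2_eq_square power3_eq_cube field_simps)
  also have "(cmod \<kappa>)\<^sup>2 = m * \<sigma> + (\<sigma> - B / 3) ^ 3 - 3 * m * (\<sigma> - B / 3)"
    unfolding norm_\<kappa> Re_cube_\<alpha>_cnj_\<beta> m_def by simp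
  also have "S = 3 * \<sigma>"
    by (simp add: \<sigma>_S)
  ultimately show ?thesis
    unfolding m rho2_denom_def
    by (simp add: power2_eq_square power3_eq_cube field_simps)
qed

lemma rho2_denom_pos: "rho2_denom B S > 0"
  unfolding rho2_denom_eq using \<sigma>_pos K_pos by simp

lemma rho_1_triangle: "rho 1 (triangle u v w) = 4 / (9 * S)"
  unfolding rho_1_triangle_norms \<delta>_square \<sigma>_S by simp

text \<open>Over the common denominator \<open>\<sigma> * G\<close> the cubic term \<open>T\<close>
  cancels, because \<open>G\<close> contains it with coefficient -16. One factor \<sigma> then
  cancels too, leaving \<open>27 * \<sigma>\<^sup>2 - 16 / 9\<close>, which is
  \<open>3 * (S\<^sup>2 - 16 / 27)\<close>.\<close>

lemma rho_2_triangle: "rho 2 (triangle u v w) = rho2_fun B S"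
proof -
  define m where "m = (cmod \<alpha>)\<^sup>2 * (cmod \<beta>)\<^sup>2"
  define G where "G = rho2_denom B S"
  define T where "T = 2 * Re ((\<alpha> * cnj \<beta>) ^ 3)"
  have m: "m = (\<sigma>\<^sup>2 - 16 / 27) / 4"
    using norm_product_eq by (simp add: m_def)
  have G: "G > 0" "100 * K = G / (4 * \<sigma>)"
    using rho2_denom_pos \<sigma>_pos by (simp_all add: G_def rho2_denom_eq)
  have GT: "G = 40 * \<sigma> ^ 3 - 36 * m * \<sigma> - 16 * T"
    unfolding G_def rho2_denom_def T_def Re_cube_\<alpha>_cnj_\<beta> m_def[symmetric] m \<sigma>_S
    by (simp add: power2_eq_square power3_eq_cube field_simps)
  have "rho 2 (triangle u v w) = 16 / 27 / (4 * \<sigma>) -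
     16 / 27 / \<sigma>\<^sup>2 * (\<sigma> ^ 3 - 3 * m * \<sigma> - T) / (G / (4 * \<sigma>))"
    unfolding rho_2_triangle_norms norm_\<eta> G(2) \<delta>_square m_def T_def by simp
  also have "\<dots> = 4 / 27 * (G - 16 * (\<sigma> ^ 3 - 3 * m * \<sigma> - T)) / (\<sigma> * G)"
    using \<sigma>_pos G(1) by (simp add: field_simps power2_eq_square)
  also have "G - 16 * (\<sigma> ^ 3 - 3 * m * \<sigma> - T) = \<sigma> * (27 * \<sigma>\<^sup>2 - 16 / 9)"
    unfolding GT m by (simp add: power2_eq_square power3_eq_cube field_simps)
  also have "4 / 27 * (\<sigma> * (27 * \<sigma>\<^sup>2 - 16 / 9)) / (\<sigma> * G) = rho2_fun B S"
    using \<sigma>_pos G(1) unfolding rho2_fun_def G_def[symmetric]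
    by (simp add: \<sigma>_S field_simps power2_eq_square)
  finally show ?thesis .
qed

lemma B_pos: "B > 0"
  using area by (auto simp: B_def signed_parallelogram_def algebra_simps)

text \<open>By the median formula, the sum of the squares of the other two sides is
  \<open>B / 2\<close> plus twice the squared median. The squared median is the squared height
  \<open>4 / B\<close> plus the squared offset of the apex from the perpendicular bisector.\<close>

lemma S_eq: "S = iso_S B + ((dist u w)\<^sup>2 - (dist v w)\<^sup>2)\<^sup>2 / (6 * B)"
proof -
  define d e where "d = u - w" and "e = v - w"
  have B: "B = (cmod (d - e))\<^sup>2"
    by (simp add: B_def d_def e_def dist_norm)
  have "B * (B + (cmod d)\<^sup>2 + (cmod e)\<^sup>2) =
      3 / 2 * B\<^sup>2 + 2 * (signed_parallelogram u v w)\<^sup>2 + ((cmod d)\<^sup>2 - (cmod e)\<^sup>2)\<^sup>2 / 2"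
    unfolding B signed_parallelogram_def d_def[symmetric] e_def[symmetric] cmod_power2
    by (simp add: power2_eq_square field_simps)
  moreover have "B + (cmod d)\<^sup>2 + (cmod e)\<^sup>2 = 3 * S"
    by (simp add: S_def B_def d_def e_def dist_norm)
  moreover define x where "x = (cmod d)\<^sup>2 - (cmod e)\<^sup>2"
  ultimately have "3 * B * S = 3 / 2 * B\<^sup>2 + 8 + x\<^sup>2 / 2"
    unfolding signed_parallelogram_square by simp
  then have "S = iso_S B + x\<^sup>2 / (6 * B)"
    using B_pos by (simp add: iso_S_def field_simps power2_eq_square)
  then show ?thesis
    unfolding x_def d_def e_def dist_norm .
qed

lemma S_ge: "S \<ge> iso_S B"
  unfolding S_eq using B_pos by simp

lemma S_eq_isosceles: "dist u w = dist v w \<Longrightarrow> S = iso_S B"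
  unfolding S_eq by simp

text \<open>Sliding the apex parallel to the base keeps the area and raises \<open>S\<close> by
  \<open>2 / 3 * \<tau>\<^sup>2 * B\<close>; \<tau> is solved from this.\<close>

lemma shifted_triangle:
  assumes iso: "dist u w = dist v w" and "s \<ge> iso_S B"
  shows "\<exists>w'. unit_area_triangle u v w' \<and> unit_area_triangle.S u v w' = s"
proof -
  define \<tau> where "\<tau> = sqrt (3 * (s - iso_S B) / (2 * B))"
  define w' where "w' = w + of_real \<tau> * (v - u)"
  have "signed_parallelogram u v w' = signed_parallelogram u v w"
    by (simp add: signed_parallelogram_def w'_def algebra_simps)
  then interpret W: unit_area_triangle u v w'
    using area by unfold_locales simp
  have "(dist u w')\<^sup>2 - (dist v w')\<^sup>2 = (dist u w)\<^sup>2 - (dist v w)\<^sup>2 + 2 * \<tau> * B"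
    unfolding B_def dist_norm w'_def cmod_power2
    by (simp add: power2_eq_square algebra_simps)
  also have "\<dots> = 2 * \<tau> * B"
    using iso by simp
  finally have "W.S = iso_S B + 2 / 3 * \<tau>\<^sup>2 * B"
    using B_pos unfolding W.S_eq
    by (simp add: power2_eq_square)
  also have "\<dots> = s"
    using assms(2) B_pos by (simp add: \<tau>_def field_simps)
  finally show ?thesis
    using W.unit_area_triangle_axioms by blast
qed

end

section \<open>Comparison with the isosceles value\<close>

lemma iso_S_ge: 
  assumes "B > 0"
  shows "(iso_S B)\<^sup>2 \<ge> 16 / 3" "iso_S B > 0"
proof -
  have "(iso_S B)\<^sup>2 - 16 / 3 = (B / 2 - 8 / (3 * B))\<^sup>2"
    using assms by (simp add: iso_S_def power2_eq_square field_simps)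
  then show "(iso_S B)\<^sup>2 \<ge> 16 / 3"
    using zero_le_power2[of "B / 2 - 8 / (3 * B)"] by linarith
  show "iso_S B > 0"
    using assms by (simp add: iso_S_def add_pos_pos)
qed

text \<open>The quotient of \<open>rho2_fun B (iso_S B) - rho2_fun B S\<close>, with denominators cleared, by \<open>S - iso_S B\<close>.\<close>
definition rho2_cofactor :: "real \<Rightarrow> real \<Rightarrow> real" where
  "rho2_cofactor B S = ((iso_S B)\<^sup>2 - 16 / 27) *
     (S\<^sup>2 + S * iso_S B + (iso_S B)\<^sup>2 + 4 / 3 * B * (S + iso_S B) - (16 / 9 * B\<^sup>2 + 16 / 27)) -
     (S + iso_S B) * rho2_denom B (iso_S B)"

lemma rho2_cofactor_eq:
  "((iso_S B)\<^sup>2 - 16 / 27) * rho2_denom B S - (S\<^sup>2 - 16 / 27) * rho2_denom B (iso_S B) =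
     (S - iso_S B) * rho2_cofactor B S"
  unfolding rho2_cofactor_def rho2_denom_def
  by (simp add: power2_eq_square power3_eq_cube field_simps)

lemma rho2_cofactor_iso:
  assumes "B > 0"
  shows "rho2_cofactor B (iso_S B) = - 4 / 729 * poly threshold_poly (B\<^sup>2) / B ^ 4"
proof -
  \<comment> \<open>After multiplication by \<open>B ^ 4\<close> everything is a polynomial in
    \<open>n\<close> and \<open>b\<close>, and \<open>n\<close> is linear in
    \<open>b\<close>.\<close>
  define n b where "n = B * iso_S B" and "b = B\<^sup>2"
  have n: "n = b / 2 + 8 / 3"
    using assms by (simp add: n_def b_def iso_S_def field_simps power2_eq_square)
  have "B ^ 4 * rho2_cofactor B (iso_S B) =
     (n\<^sup>2 - 16 / 27 * b) * (3 * n\<^sup>2 + 8 / 3 * b * n - (16 / 9 * b + 16 / 27) * b) -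
     2 * n * (n ^ 3 + 4 / 3 * b * n\<^sup>2 - (16 / 9 * b + 16 / 27) * b * n + 16 / 27 * b ^ 3 + 64 / 27 * b\<^sup>2)"
    unfolding n_def b_def rho2_cofactor_def rho2_denom_def by (simp add: eval_nat_numeral algebra_simps)
  also have "\<dots> = - 4 / 729 * poly threshold_poly b"
    unfolding n poly_threshold_poly by (simp add: eval_nat_numeral field_simps)
  finally have "B ^ 4 * rho2_cofactor B (iso_S B) = - 4 / 729 * poly threshold_poly (B\<^sup>2)"
    unfolding b_def .
  moreover have "B ^ 4 \<noteq> 0"
    using assms by simp
  ultimately show ?thesis
    by (metis nonzero_mult_div_cancel_left)
qed

text \<open>Subtracting the value at \<open>S0\<close> leaves \<open>S - S0\<close> times a linear
  function of \<open>S\<close> with slope \<open>A > 0\<close>. Nonnegativity at \<open>S0\<close>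
  bounds \<open>G\<close> from above, and this bound makes the linear factor nonnegative from
  \<open>S0\<close> on.\<close>

lemma rho2_cofactor_nonneg:
  assumes "B > 0" and th: "poly threshold_poly (B\<^sup>2) \<le> 0" and S: "S \<ge> iso_S B"
  shows "rho2_cofactor B S \<ge> 0"
proof -
  define S0 A G where "S0 = iso_S B" and "A = S0\<^sup>2 - 16 / 27" and "G = rho2_denom B S0"
  have A: "A > 0" and S0: "S0 > 0"
    using iso_S_ge[OF \<open>B > 0\<close>] by (simp_all add: A_def S0_def)
  have Q0: "rho2_cofactor B S0 \<ge> 0"
    using th \<open>B > 0\<close> unfolding S0_def rho2_cofactor_iso[OF \<open>B > 0\<close>]
    by (simp add: field_simps)
  have "2 * S0 * G = A * (3 * S0\<^sup>2 + 8 / 3 * B * S0 - (16 / 9 * B\<^sup>2 + 16 / 27)) - rho2_cofactor B S0"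
    unfolding rho2_cofactor_def S0_def[symmetric] A_def[symmetric] G_def[symmetric]
    by (simp add: power2_eq_square algebra_simps)
  also have "\<dots> \<le> A * (6 * S0\<^sup>2 + 8 / 3 * B * S0)"
  proof -
    have "3 * S0\<^sup>2 + 8 / 3 * B * S0 - (16 / 9 * B\<^sup>2 + 16 / 27) \<le> 6 * S0\<^sup>2 + 8 / 3 * B * S0"
      using zero_le_power2[of S0] zero_le_power2[of B] by linarith
    then have "A * (3 * S0\<^sup>2 + 8 / 3 * B * S0 - (16 / 9 * B\<^sup>2 + 16 / 27)) \<le> A * (6 * S0\<^sup>2 + 8 / 3 * B * S0)"
      using A by (intro mult_left_mono) simp_all
    then show ?thesis
      using Q0 by linarith
  qed
  also have "\<dots> = 2 * S0 * (A * (3 * S0 + 4 / 3 * B))"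
    by (simp add: power2_eq_square algebra_simps)
  finally have G: "G \<le> A * (3 * S0 + 4 / 3 * B)"
    using S0 by simp
  also have "\<dots> \<le> A * (S + 2 * S0 + 4 / 3 * B)"
    using A S by (intro mult_left_mono) (auto simp: S0_def)
  finally have "0 \<le> (S - S0) * (A * (S + 2 * S0 + 4 / 3 * B) - G)"
    using S by (simp add: S0_def)
  also have "\<dots> = rho2_cofactor B S - rho2_cofactor B S0"
    unfolding rho2_cofactor_def S0_def[symmetric] A_def[symmetric] G_def[symmetric]
    by (simp add: power2_eq_square field_simps)
  finally show ?thesis
    using Q0 by simp
qed

lemma rho2_fun_le_iff:
  assumes "rho2_denom B S > 0" "rho2_denom B (iso_S B) > 0"
  shows "rho2_fun B S \<le> rho2_fun B (iso_S B) \<longleftrightarrow> 0 \<le> (S - iso_S B) * rho2_cofactor B S"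
proof -
  have "4 / 9 * x / rho2_denom B S \<le> 4 / 9 * y / rho2_denom B (iso_S B) \<longleftrightarrow>
      x * rho2_denom B (iso_S B) \<le> y * rho2_denom B S" for x y
    using assms by (simp add: field_simps)
  then show ?thesis
    by (simp only: rho2_cofactor_eq [symmetric] rho2_fun_def diff_ge_0_iff_ge)
qed

section \<open>Sign of the threshold polynomial\<close>

lemma t_star_pos: "t_star > 0" and poly_threshold_poly_t_star: "poly threshold_poly t_star = 0"
  using theI'[OF ex1_threshold_root] by (simp_all add: t_star_def)

text \<open>Cross-multiplying the values at \<open>x\<close> and \<open>t_star\<close> by fourth
  powers eliminates the leading coefficient. The other coefficients are negative, so the difference
  is \<open>x - t_star\<close> times the positive quantity \<open>W\<close>.\<close>

lemma threshold_poly_nonpos_iff: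
  assumes "x > 0"
  shows "poly threshold_poly x \<le> 0 \<longleftrightarrow> x \<le> t_star"
proof -
  note t = t_star_pos poly_threshold_poly_t_star
  define W where "W = 93 * t_star ^ 3 * x ^ 3 + 664 * t_star\<^sup>2 * x\<^sup>2 * (x + t_star) +
    5376 * t_star * x * (x\<^sup>2 + x * t_star + t_star\<^sup>2) + 9216 * (x + t_star) * (x\<^sup>2 + t_star\<^sup>2)"
  have "W > 0"
    unfolding W_def using t(1) assms by (intro add_pos_pos mult_pos_pos) simp_all
  have "poly threshold_poly x * t_star ^ 4 = (x - t_star) * W + poly threshold_poly t_star * x ^ 4"
    unfolding poly_threshold_poly W_def by (simp add: eval_nat_numeral algebra_simps)
  then have "poly threshold_poly x * t_star ^ 4 = (x - t_star) * W"
    using t(2) by simp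
  moreover have "poly threshold_poly x \<le> 0 \<longleftrightarrow> poly threshold_poly x * t_star ^ 4 \<le> 0"
    using t(1) by (simp add: mult_le_0_iff)
  ultimately show ?thesis
    using \<open>W > 0\<close> by (simp add: mult_le_0_iff)
qed

lemma le_root_t_star_iff:
  assumes "a > 0"
  shows "a \<le> root 4 t_star \<longleftrightarrow> poly threshold_poly ((a\<^sup>2)\<^sup>2) \<le> 0"
proof -
  have "a \<le> root 4 t_star \<longleftrightarrow> root 4 (a ^ 4) \<le> root 4 t_star"
    using assms by (simp add: real_root_pos2)
  also have "\<dots> \<longleftrightarrow> (a\<^sup>2)\<^sup>2 \<le> t_star"
    by (simp add: power_mult [symmetric])
  finally show ?thesis
    using assms by (simp add: threshold_poly_nonpos_iff)
qed

section \<open>Maximality among triangles with a given side\<close>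

lemma unit_area_triangle_iff:
  "unit_area_triangle u v w \<longleftrightarrow> \<not> collinear {u, v, w} \<and> measure lborel (triangle u v w) = 1"
  by (cases "collinear {u, v, w}")
     (simp_all add: unit_area_triangle_def measure_triangle, simp add: collinear_iff_signed_parallelogram)

lemma unit_triangles_with_side_iff:
  "T \<in> unit_triangles_with_side a \<longleftrightarrow>
     (\<exists>u v w. T = triangle u v w \<and> unit_area_triangle u v w \<and> dist u v = a)"
  unfolding unit_triangles_with_side_def unit_area_triangle_iff by blast

lemma isosceles_unit_triangles_iff:
  "T \<in> isosceles_unit_triangles a \<longleftrightarrow>
     (\<exists>u v w. T = triangle u v w \<and> unit_area_triangle u v w \<and> dist u v = a \<and> dist u w = dist v w)"
  unfolding isosceles_unit_triangles_def unit_area_triangle_iff by blast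

lemma isosceles_maximizes_rho_1:
  assumes "a > 0" and T: "T \<in> isosceles_unit_triangles a"
  shows "maximizes_rho 1 T (unit_triangles_with_side a)"
  unfolding maximizes_rho_def
proof (intro conjI ballI)
  obtain u v w where uvw: "T = triangle u v w" "unit_area_triangle u v w" "dist u v = a" "dist u w = dist v w"
    using T by (auto simp: isosceles_unit_triangles_iff)
  then show "T \<in> unit_triangles_with_side a"
    by (auto simp: unit_triangles_with_side_iff)
  interpret T: unit_area_triangle u v w by fact
  fix T' assume "T' \<in> unit_triangles_with_side a"
  then obtain u' v' w' where uvw': "T' = triangle u' v' w'" "unit_area_triangle u' v' w'" "dist u' v' = a"
    by (auto simp: unit_triangles_with_side_iff)
  interpret T': unit_area_triangle u' v' w' by fact
  have "T.S = iso_S (a\<^sup>2)" "T'.S \<ge> iso_S (a\<^sup>2)"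
    using T.S_eq_isosceles T'.S_ge uvw uvw' by (simp_all add: T.B_def T'.B_def)
  moreover have "iso_S (a\<^sup>2) > 0"
    using iso_S_ge(2) assms(1) by simp
  ultimately show "rho 1 T' \<le> rho 1 T"
    unfolding uvw(1) uvw'(1) T.rho_1_triangle T'.rho_1_triangle by (simp add: frac_le)
qed

lemma isosceles_maximizes_rho_2_iff:
  assumes "a > 0" and T: "T \<in> isosceles_unit_triangles a"
  shows "maximizes_rho 2 T (unit_triangles_with_side a) \<longleftrightarrow> poly threshold_poly ((a\<^sup>2)\<^sup>2) \<le> 0"
proof -
  define B where "B = a\<^sup>2"
  have "B > 0" using assms by (simp add: B_def)
  obtain u v w where uvw: "T = triangle u v w" "unit_area_triangle u v w" "dist u v = a" "dist u w = dist v w"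
    using T by (auto simp: isosceles_unit_triangles_iff)
  interpret T: unit_area_triangle u v w by fact
  have TB: "T.B = B" "T.S = iso_S B"
    using T.S_eq_isosceles uvw by (simp_all add: T.B_def B_def)
  have le_iff: "rho 2 (triangle u' v' w') \<le> rho 2 T \<longleftrightarrow>
      0 \<le> (unit_area_triangle.S u' v' w' - iso_S B) * rho2_cofactor B (unit_area_triangle.S u' v' w')"
    if "unit_area_triangle u' v' w'" "dist u' v' = a" for u' v' w'
  proof -
    interpret T': unit_area_triangle u' v' w' by fact
    have "T'.B = B"
      using that by (simp add: T'.B_def B_def)
    then show ?thesis
      using rho2_fun_le_iff T.rho2_denom_pos T'.rho2_denom_pos
      by (simp add: uvw(1) T.rho_2_triangle T'.rho_2_triangle TB)
  qed
  show ?thesis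
    unfolding B_def [symmetric]
  proof
    assume th: "poly threshold_poly (B\<^sup>2) \<le> 0"
    show "maximizes_rho 2 T (unit_triangles_with_side a)"
      unfolding maximizes_rho_def
    proof (intro conjI ballI)
      show "T \<in> unit_triangles_with_side a"
        using uvw by (auto simp: unit_triangles_with_side_iff)
      fix T' assume "T' \<in> unit_triangles_with_side a"
      then obtain u' v' w' where uvw': "T' = triangle u' v' w'" "unit_area_triangle u' v' w'" "dist u' v' = a"
        by (auto simp: unit_triangles_with_side_iff)
      interpret T': unit_area_triangle u' v' w' by fact
      have "T'.S \<ge> iso_S B"
        using T'.S_ge uvw' by (simp add: T'.B_def B_def)
      then show "rho 2 T' \<le> rho 2 T"
        using rho2_cofactor_nonneg[OF \<open>B > 0\<close> th] unfolding uvw'(1) le_iff[OF uvw'(2,3)] by simp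
    qed
  next
    assume max: "maximizes_rho 2 T (unit_triangles_with_side a)"
    show "poly threshold_poly (B\<^sup>2) \<le> 0"
    proof (rule ccontr)
      assume "\<not> poly threshold_poly (B\<^sup>2) \<le> 0"
      then have "rho2_cofactor B (iso_S B) < 0"
        using \<open>B > 0\<close> by (simp add: rho2_cofactor_iso)
      \<comment> \<open>At \<open>iso_S B\<close> itself the comparison is an equality. Continuity
        carries the strict sign to some larger \<open>s\<close>, where the factor
        \<open>s - iso_S B\<close> is positive and a shifted triangle realizes
        \<open>s\<close>.\<close>
      moreover have "(rho2_cofactor B \<longlongrightarrow> rho2_cofactor B (iso_S B)) (at_right (iso_S B))"
        unfolding rho2_cofactor_def by (intro tendsto_intros)
      ultimately have "eventually (\<lambda>s. rho2_cofactor B s < 0) (at_right (iso_S B))"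
        by (rule order_tendstoD(2)[rotated])
      moreover have "eventually (\<lambda>s. s > iso_S B) (at_right (iso_S B))"
        by (rule eventually_at_right_less)
      ultimately have "eventually (\<lambda>s. rho2_cofactor B s < 0 \<and> s > iso_S B) (at_right (iso_S B))"
        by (rule eventually_conj)
      then obtain s where s: "rho2_cofactor B s < 0" "s > iso_S B"
        using eventually_happens' trivial_limit_at_right_real by blast
      obtain w' where w': "unit_area_triangle u v w'" "unit_area_triangle.S u v w' = s"
        using T.shifted_triangle[OF uvw(4), of s] s(2) unfolding TB by auto
      then have "triangle u v w' \<in> unit_triangles_with_side a"
        using uvw(3) by (auto simp: unit_triangles_with_side_iff)
      then have "rho 2 (triangle u v w') \<le> rho 2 T"
        using max by (simp add: maximizes_rho_def)
      then have "0 \<le> (s - iso_S B) * rho2_cofactor B s"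
        using le_iff[OF w'(1) uvw(3)] w'(2) by simp
      then show False
        using s by (simp add: zero_le_mult_iff)
    qed
  qed
qed

theorem theorem2p7:
  shows "(\<forall>a>0. \<forall>T\<in>isosceles_unit_triangles a. maximizes_rho 1 T (unit_triangles_with_side a)) \<and>
    (\<exists>!t. 0 < t \<and> poly threshold_poly t = 0) \<and>
    (\<forall>a. 0 < a \<and> a \<le> root 4 t_star \<longrightarrow>
      (\<forall>T\<in>isosceles_unit_triangles a. maximizes_rho 2 T (unit_triangles_with_side a))) \<and>
    (\<forall>a. a > root 4 t_star \<longrightarrow>
      (\<forall>T\<in>isosceles_unit_triangles a. \<not> maximizes_rho 2 T (unit_triangles_with_side a)))"
proof (intro conjI allI impI ballI)
  show "\<exists>!t. 0 < t \<and> poly threshold_poly t = 0"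
    by (rule ex1_threshold_root)
next
  fix a T assume "root 4 t_star < a" "T \<in> isosceles_unit_triangles a"
  \<comment> \<open>This clause does not assume that \<open>a\<close> is positive; it follows from
    \<open>t_star > 0\<close>.\<close>
  moreover from this have "a > 0"
    using t_star_pos real_root_gt_zero[of 4 t_star] by linarith
  ultimately show "\<not> maximizes_rho 2 T (unit_triangles_with_side a)"
    using le_root_t_star_iff[of a] isosceles_maximizes_rho_2_iff[of a T] by simp
qed (auto simp: isosceles_maximizes_rho_2_iff le_root_t_star_iff intro: isosceles_maximizes_rho_1
      simp del: One_nat_def)

end
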